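(* Let $p=2$, let $d>k\ge1$ be integers and $a\in\mathbb{R}$ with $k+a>2$. Put $\mathrm{H}_b=\frac{d+a-2-b}{2}$ for $b\in\mathbb{R}$ (so $\mathrm{H}_0=\frac{d+a-2}{2}$) and $\Lambda_0=\frac{k+a-2}{2}$. Then $b_*$ is the smallest root of the equation $b^2-4\mathrm{H}_0b+4(\mathrm{H}_0-\Lambda_0)^2=0$, that is, $$b_*=2\mathrm{H}_0-2\sqrt{\mathrm{H}_0^2-(\mathrm{H}_0-\Lambda_0)^2}\in(0,2\mathrm{H}_0).$$ Moreover, for $b\in(b_*,2\mathrm{H}_0)$ it holds that $$S_{b,b}=\Lambda_0^2-\Big(\sqrt{\mathrm{H}_0^2-\mathrm{H}_b^2}-(\mathrm{H}_0-\Lambda_0)\Big)^2 .$$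
   Context: Write $\mathbb{R}^d\equiv\mathbb{R}^k\times\mathbb{R}^{d-k}\ni (y,x)\equiv z$. For $b<2\mathrm{H}_0=d+a-2$, $S_{b,b}$ is the best constant in $S_{b,b}\int_{\mathbb{R}^d}|y|^{a-2}|z|^{-b}|u|^2\,dz\le\int_{\mathbb{R}^d}|y|^{a}|z|^{-b}|\nabla u|^2\,dz$, $u\in C_c^\infty(\mathbb{R}^d)$; i.e. the infimum over $u\in C_c^\infty(\mathbb{R}^d)\setminus\{0\}$ of the quotient of the right-hand integral by the left-hand integral. The number $b_*\in[0,2\mathrm{H}_0)$ is the one (which exists and is unique) such that $S_{b,b}=\Lambda_0^2$ if $b\le b_*$ and $S_{b,b}<\Lambda_0^2$ if $b_*<b<2\mathrm{H}_0$. *)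

theory Defs
  imports "HOL-Analysis.Analysis"
begin

text \<open>
  Functions of class \<open>C\<^sup>n\<close> and \<open>C\<^sup>\<infinity>\<close> on the whole space: all iterated directional derivatives
  up to order \<open>n\<close> exist as Frechet derivatives and are continuous.
\<close>

primrec Cn :: "nat \<Rightarrow> ('a::euclidean_space \<Rightarrow> real) \<Rightarrow> bool" where
  "Cn 0 u \<longleftrightarrow> continuous_on UNIV u"
| "Cn (Suc n) u \<longleftrightarrow>
     (\<forall>z. u differentiable at z) \<and> (\<forall>v. Cn n (\<lambda>z. frechet_derivative u (at z) v))"

definition Cc_infinity :: "('a::euclidean_space \<Rightarrow> real) set" where
  "Cc_infinity = {u. (\<forall>n. Cn n u) \<and> compact (closure {z. u z \<noteq> 0})}"

definition grad :: "('a::euclidean_space \<Rightarrow> real) \<Rightarrow> 'a \<Rightarrow> 'a" where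
  "grad u z = (THE D. GDERIV u z :> D)"

definition H :: "nat \<Rightarrow> real \<Rightarrow> real \<Rightarrow> real" where
  "H d a b = (real d + a - 2 - b) / 2"

definition Lambda0 :: "nat \<Rightarrow> real \<Rightarrow> real" where
  "Lambda0 k a = (real k + a - 2) / 2"

text \<open>
  Points of \<open>\<real>\<^sup>k \<times> \<real>\<^sup>d\<^sup>-\<^sup>k\<close> are pairs \<open>z = (y, x)\<close>, so \<open>fst z\<close> is \<open>y\<close> and \<open>norm z\<close> is the Euclidean
  norm on \<open>\<real>\<^sup>d\<close>. The convention \<open>0 powr s = 0\<close> only matters on the null set \<open>{z. fst z = 0}\<close>.
\<close>

definition energy :: "real \<Rightarrow> real \<Rightarrow> ((real^'k::finite) \<times> (real^'m::finite) \<Rightarrow> real) \<Rightarrow> real" where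
  "energy a b u =
     (\<integral>z. norm (fst z) powr a * norm z powr (- b) * (norm (grad u z))\<^sup>2 \<partial>lborel)"

definition mass :: "real \<Rightarrow> real \<Rightarrow> ((real^'k::finite) \<times> (real^'m::finite) \<Rightarrow> real) \<Rightarrow> real" where
  "mass a b u =
     (\<integral>z. norm (fst z) powr (a - 2) * norm z powr (- b) * \<bar>u z\<bar>\<^sup>2 \<partial>lborel)"

text \<open>
  The type arguments carry the dimensions \<open>k\<close> and \<open>d - k\<close>. The constant is meaningful for
  \<open>k + a > 2\<close> and \<open>b < 2 H\<^sub>0\<close>, when both integrals are finite for every test function.
\<close>

definition best_const :: "'k::finite itself \<Rightarrow> 'm::finite itself \<Rightarrow> real \<Rightarrow> real \<Rightarrow> real" where
  "best_const _ _ a b =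
     Inf {energy a b u / mass a b u | u :: (real^'k::finite) \<times> (real^'m::finite) \<Rightarrow> real.
            u \<in> Cc_infinity \<and> u \<noteq> (\<lambda>_. 0)}"

definition is_b_star :: "'k::finite itself \<Rightarrow> 'm::finite itself \<Rightarrow> real \<Rightarrow> real \<Rightarrow> bool" where
  "is_b_star K M a \<beta> \<longleftrightarrow>
     (let k = CARD('k); d = CARD('k) + CARD('m) in
        0 \<le> \<beta> \<and> \<beta> < 2 * H d a 0 \<and>
        (\<forall>b \<le> \<beta>. best_const K M a b = (Lambda0 k a)\<^sup>2) \<and>
        (\<forall>b. \<beta> < b \<and> b < 2 * H d a 0 \<longrightarrow> best_const K M a b < (Lambda0 k a)\<^sup>2))"

definition b_star :: "'k::finite itself \<Rightarrow> 'm::finite itself \<Rightarrow> real \<Rightarrow> real" where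
  "b_star K M a = (THE \<beta>. is_b_star K M a \<beta>)"

end

theory Submission
  imports Defs
begin

text \<open>
  Write \<open>L = \<Lambda>\<^sub>0\<close>, \<open>w = |y|\<^sup>a |z|\<^sup>-\<^sup>b\<close>, \<open>m = d - k = 2 (H\<^sub>0 - L)\<close>. Both bounds on the best constant come
  from one identity. For exponents \<open>\<sigma>, \<tau>\<close> let \<open>V = \<sigma> y / |y|\<^sup>2 + \<tau> z / |z|\<^sup>2\<close>, the logarithmic gradient of
  \<open>|y|\<^sup>\<sigma> |z|\<^sup>\<tau>\<close>. Expanding \<open>w |\<nabla>u - u V|\<^sup>2\<close> and integrating the cross term by parts gives, after the
  optimal choice \<open>\<sigma> = s - L\<close>, \<open>\<tau> = - (H\<^sub>b + \<sigma>)\<close>,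

    energy \<open>u = (L\<^sup>2 - s\<^sup>2)\<close> mass \<open>u + C(s) \<integral> w |z|\<^sup>-\<^sup>2 u\<^sup>2 + \<integral> w |\<nabla>u - u V|\<^sup>2\<close>,
    where \<open>C(s) = (s + m/2)\<^sup>2 - (H\<^sub>0\<^sup>2 - H\<^sub>b\<^sup>2)\<close>,

  for every real \<open>s\<close> (\<open>energy_identity\<close>). The integration by parts only involves the fields \<open>y\<close> and \<open>z\<close>,
  which generate the dilations \<open>(y, x) \<mapsto> (e\<^sup>t y, x)\<close> and \<open>z \<mapsto> e\<^sup>t z\<close>; it is therefore the derivative of the
  change of variables formula along these flows (\<open>weighted_dilation_identity\<close>). Both flows preserve the
  set \<open>{y = 0}\<close> on which the weight is singular.

  Lower bound: if \<open>C(s) \<ge> 0\<close>, then the best constant is at least \<open>L\<^sup>2 - s\<^sup>2\<close>.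

  Upper bound: the last integral vanishes formally for \<open>u = |y|\<^sup>\<sigma> |z|\<^sup>\<tau>\<close>. Cutting this function off at
  distances \<open>e\<^sup>-\<^sup>n\<close> and \<open>e\<^sup>n\<close> on a logarithmic scale makes that integral \<open>O(1/n)\<close>, whereas the mass grows like
  \<open>n\<close>, because \<open>w |y|\<^sup>-\<^sup>2 |y|\<^sup>2\<^sup>\<sigma> |z|\<^sup>2\<^sup>\<tau>\<close> is homogeneous of degree \<open>-d\<close> and, for \<open>s > 0\<close>, integrable on the
  unit shell (\<open>near_extremals\<close>). To control the middle term as well, the identity is compared with
  itself at \<open>s\<close> and \<open>2 s\<close>: for such \<open>u\<close> the ratio of \<open>\<integral> w |z|\<^sup>-\<^sup>2 u\<^sup>2\<close> to the mass is at most about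
  \<open>3 s / m\<close>. Hence the best constant is at most \<open>L\<^sup>2 - s\<^sup>2 + 3 s |C(s)| / m\<close> for every \<open>s > 0\<close>
  (\<open>best_const_upper\<close>).

  If \<open>C(0) \<ge> 0\<close>, then \<open>s = 0\<close> below and \<open>s \<rightarrow> 0\<close> above give the value \<open>L\<^sup>2\<close>. If \<open>C(0) < 0\<close>, then the positive
  root \<open>s = sqrt (H\<^sub>0\<^sup>2 - H\<^sub>b\<^sup>2) - m/2\<close> of \<open>C\<close> gives \<open>L\<^sup>2 - s\<^sup>2\<close> in both directions. Since
  \<open>4 C(0) = b\<^sup>2 - 4 H\<^sub>0 b + 4 (H\<^sub>0 - L)\<^sup>2\<close>, the transition takes place at the smaller root of this quadratic.
\<close>

section \<open>Calculus of C^n functions\<close>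

lemma Cn_continuous: "Cn n u \<Longrightarrow> continuous_on UNIV u"
  by (cases n) (auto simp: continuous_on_eq_continuous_at differentiable_imp_continuous_within)

lemma Cn_Suc_imp: "Cn (Suc n) u \<Longrightarrow> Cn n u"
proof (induction n arbitrary: u)
  case 0
  then show ?case using Cn_continuous[of "Suc 0" u] by simp
next
  case (Suc n)
  show ?case
    unfolding Cn.simps(2)
  proof (intro conjI allI)
    fix z v
    show "u differentiable at z" using Suc.prems by simp
    have "Cn (Suc n) (\<lambda>z. frechet_derivative u (at z) v)"
      using Suc.prems unfolding Cn.simps(2)[of "Suc n"] by blast
    then show "Cn n (\<lambda>z. frechet_derivative u (at z) v)" by (rule Suc.IH)
  qed
qed

lemma Cn_const: "Cn n (\<lambda>z. c)"
proof (induction n arbitrary: c)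
  case (Suc n)
  have "frechet_derivative (\<lambda>z. c) (at z) v = 0" for z v :: 'a
    by (simp add: frechet_derivative_const)
  then show ?case using Suc[of 0] by simp
qed simp

text \<open>
  Differentiability is recorded through \<open>frechet_derivative\<close>; this rule accepts any family of
  derivatives, so that closure properties follow by induction from the usual derivative rules.
\<close>

lemma Cn_SucI:
  assumes "\<And>z. (u has_derivative u' z) (at z)" "\<And>v. Cn n (\<lambda>z. u' z v)"
  shows "Cn (Suc n) u"
proof -
  have "frechet_derivative u (at z) = u' z" for z
    using frechet_derivative_at[OF assms(1)] by simp
  then show ?thesis using assms by (auto simp: differentiable_def)
qed

lemma Cn_SucD:
  assumes "Cn (Suc n) u"
  shows "(u has_derivative frechet_derivative u (at z)) (at z)"
        "Cn n (\<lambda>z. frechet_derivative u (at z) v)"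
  using assms by (auto simp: frechet_derivative_works)

lemma Cn_bounded_linear:
  fixes f :: "'a::euclidean_space \<Rightarrow> real"
  assumes "bounded_linear f"
  shows "Cn n f"
proof (cases n)
  case 0
  then show ?thesis using assms linear_continuous_on by simp
next
  case (Suc m)
  then show ?thesis
    using Cn_SucI[of f "\<lambda>_. f" m, OF bounded_linear_imp_has_derivative[OF assms] Cn_const] by simp
qed

lemma Cn_add: "Cn n u \<Longrightarrow> Cn n v \<Longrightarrow> Cn n (\<lambda>z. u z + v z)"
proof (induction n arbitrary: u v)
  case (Suc n)
  show ?case
    by (rule Cn_SucI[OF has_derivative_add[OF Cn_SucD(1)[OF Suc.prems(1)] Cn_SucD(1)[OF Suc.prems(2)]]])
       (intro Suc.IH Cn_SucD(2)[OF Suc.prems(1)] Cn_SucD(2)[OF Suc.prems(2)])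
qed (simp add: continuous_on_add)

lemma Cn_mult: "Cn n u \<Longrightarrow> Cn n v \<Longrightarrow> Cn n (\<lambda>z. u z * v z)"
proof (induction n arbitrary: u v)
  case (Suc n)
  show ?case
    by (rule Cn_SucI[OF has_derivative_mult[OF Cn_SucD(1)[OF Suc.prems(1)] Cn_SucD(1)[OF Suc.prems(2)]]])
       (intro Cn_add Suc.IH Cn_SucD(2)[OF Suc.prems(1)] Cn_SucD(2)[OF Suc.prems(2)]
          Cn_Suc_imp[OF Suc.prems(1)] Cn_Suc_imp[OF Suc.prems(2)])
qed (simp add: continuous_on_mult)

text \<open>
  By the chain rule \<open>D(f \<circ> u) v = f'(u) \<cdot> Du v\<close>, which is again a product of a composition with a
  derivative of \<open>u\<close>; the induction therefore has to run over all \<open>f\<close> and \<open>u\<close> at once.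
\<close>

lemma Cn_compose:
  fixes f :: "real \<Rightarrow> real"
  shows "Cn n f \<Longrightarrow> Cn n u \<Longrightarrow> Cn n (\<lambda>z. f (u z))"
proof (induction n arbitrary: f u)
  case 0
  then show ?case
    using continuous_on_compose2[of UNIV f UNIV u] by simp
next
  case (Suc n)
  have lin: "frechet_derivative f (at x) t = t * frechet_derivative f (at x) 1" for x t
  proof -
    have "linear (frechet_derivative f (at x))"
      by (rule has_derivative_linear[OF Cn_SucD(1)[OF Suc.prems(1)]])
    from linear_scale[OF this, of t 1] show ?thesis by simp
  qed
  have d: "((\<lambda>z. f (u z)) has_derivative
      (\<lambda>v. frechet_derivative u (at z) v * frechet_derivative f (at (u z)) 1)) (at z)" for z
    using has_derivative_compose[OF Cn_SucD(1)[OF Suc.prems(2)] Cn_SucD(1)[OF Suc.prems(1)], of z]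
    by (subst (asm) lin) simp
  show ?case
    by (rule Cn_SucI[OF d], rule Cn_mult, rule Cn_SucD(2)[OF Suc.prems(2)], rule Suc.IH,
        rule Cn_SucD(2)[OF Suc.prems(1)], rule Cn_Suc_imp[OF Suc.prems(2)])
qed

lemma Cn_SucI_real:
  assumes "\<And>t. (f has_real_derivative f' t) (at t)" "Cn n f'"
  shows "Cn (Suc n) f"
proof (rule Cn_SucI)
  show "(f has_derivative (\<lambda>v. f' t * v)) (at t)" for t
    using assms(1) by (simp add: has_field_derivative_def)
  show "Cn n (\<lambda>z. f' z * v)" for v
    by (intro Cn_mult assms Cn_const)
qed

lemma Cn_inner_self:
  fixes f :: "'a::euclidean_space \<Rightarrow> 'b::euclidean_space"
  assumes "bounded_linear f"
  shows "Cn n (\<lambda>z. f z \<bullet> f z)"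
proof -
  have "Cn n (\<lambda>z. \<Sum>b\<in>B. (f z \<bullet> b) * (f z \<bullet> b))" if "finite B" for B
    using that
  proof (induction B rule: finite_induct)
    case (insert b B)
    have "Cn n (\<lambda>z. f z \<bullet> b)"
      by (intro Cn_bounded_linear bounded_linear_compose[OF bounded_linear_inner_left assms])
    then show ?case using insert by (simp add: Cn_add Cn_mult)
  qed (simp add: Cn_const)
  then show ?thesis by (subst euclidean_inner) simp
qed


section \<open>A smooth bump and logarithmic cutoffs\<close>

text \<open>
  The functions \<open>t\<^sup>-\<^sup>m exp (-1/t)\<close>, extended by \<open>0\<close>. Up to linear combinations the family is closed under
  differentiation, so all its members are smooth, including at \<open>0\<close>.
\<close>

definition flat_exp :: "nat \<Rightarrow> real \<Rightarrow> real" where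
  "flat_exp m t = (if 0 < t then (1 / t) ^ m * exp (- (1 / t)) else 0)"

lemma flat_exp_tendsto_0: "(flat_exp m \<longlongrightarrow> 0) (at 0)"
proof -
  have "((\<lambda>t. (1 / t) ^ m / exp (1 / t)) \<longlongrightarrow> 0) (at_right (0::real))"
    using filterlim_compose[OF tendsto_power_div_exp_0 filterlim_inverse_at_top_right, of m]
    by (simp add: inverse_eq_divide)
  then have "(flat_exp m \<longlongrightarrow> 0) (at_right 0)"
    by (rule Lim_transform_eventually)
       (auto simp: eventually_at_right_field flat_exp_def exp_minus field_simps intro!: exI[of _ 1])
  moreover have "(flat_exp m \<longlongrightarrow> 0) (at_left 0)"
    by (rule Lim_transform_eventually[OF tendsto_const])
       (auto simp: eventually_at_left_field flat_exp_def intro!: exI[of _ "-1"])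
  ultimately show ?thesis by (simp add: filterlim_split_at)
qed

lemma flat_exp_has_real_derivative:
  "(flat_exp m has_real_derivative flat_exp (m + 2) t - real m * flat_exp (m + 1) t) (at t)"
proof -
  consider "t > 0" | "t < 0" | "t = 0" by linarith
  then show ?thesis
  proof cases
    case 1
    have e1: "real m * (1 / t) ^ (m - 1) * (- (1 / t\<^sup>2)) = - (real m * (1 / t) ^ (m + 1))"
      by (cases m) (simp_all add: power2_eq_square)
    have e2: "(1 / t) ^ (m + 2) = (1 / t\<^sup>2) * (1 / t) ^ m"
      by (simp add: power_add power2_eq_square)
    have "((\<lambda>t. (1 / t) ^ m * exp (- (1 / t))) has_real_derivative
        (real m * (1 / t) ^ (m - 1) * (- (1 / t\<^sup>2))) * exp (- (1 / t))
          + (exp (- (1 / t)) * (1 / t\<^sup>2)) * (1 / t) ^ m) (at t)"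
      using 1 by (auto intro!: derivative_eq_intros simp: power2_eq_square)
    then have "((\<lambda>t. (1 / t) ^ m * exp (- (1 / t))) has_real_derivative
        flat_exp (m + 2) t - real m * flat_exp (m + 1) t) (at t)"
      by (rule DERIV_cong) (use 1 in \<open>simp only: e1 e2 flat_exp_def if_True, simp add: mult_ac\<close>)
    then show ?thesis
      by (rule has_field_derivative_transform_within_open[of _ _ _ "{0<..}"])
         (use 1 in \<open>auto simp: flat_exp_def\<close>)
  next
    case 2
    have "((\<lambda>t. 0) has_real_derivative 0) (at t)" by simp
    then have "(flat_exp m has_real_derivative 0) (at t)"
      by (rule has_field_derivative_transform_within_open[of _ _ _ "{..<0}"])
         (use 2 in \<open>auto simp: flat_exp_def\<close>)
    then show ?thesis using 2 by (simp add: flat_exp_def)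
  next
    case 3
    have "((\<lambda>h. (flat_exp m (0 + h) - flat_exp m 0) / h) \<longlongrightarrow> 0) (at 0)"
      by (rule Lim_transform_eventually[OF flat_exp_tendsto_0[of "m + 1"]])
         (auto simp: flat_exp_def eventually_at_filter)
    then show ?thesis using 3 by (simp add: DERIV_def flat_exp_def)
  qed
qed

lemma Cn_flat_exp: "Cn n (flat_exp m)"
proof (induction n arbitrary: m)
  case 0
  show ?case
    using DERIV_continuous[OF flat_exp_has_real_derivative]
    by (simp add: continuous_on_eq_continuous_at)
next
  case (Suc n)
  have "Cn n (\<lambda>t. flat_exp (m + 2) t + (- real m) * flat_exp (m + 1) t)"
    by (intro Cn_add Cn_mult Cn_const Suc)
  then show ?case
    by (intro Cn_SucI_real[OF flat_exp_has_real_derivative]) simp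
qed

definition bump :: "real \<Rightarrow> real" where
  "bump t = flat_exp 0 (1 - t) * flat_exp 0 (1 + t)"

lemma bump_eq_0: "1 \<le> \<bar>t\<bar> \<Longrightarrow> bump t = 0"
  by (auto simp: bump_def flat_exp_def)

lemma Cn_bump: "Cn n bump"
proof -
  have "Cn n (\<lambda>t. c + s * t :: real)" for c s
    by (intro Cn_add Cn_const Cn_bounded_linear bounded_linear_mult_right)
  from this[of 1 1] this[of 1 "-1"] show ?thesis
    unfolding bump_def[abs_def] by (intro Cn_mult Cn_compose[OF Cn_flat_exp]) simp_all
qed

lemma deriv_Cn_real:
  fixes f :: "real \<Rightarrow> real"
  assumes "Cn (Suc n) f"
  shows "(f has_real_derivative deriv f t) (at t)" "Cn n (deriv f)"
proof -
  show *: "(f has_real_derivative deriv f t) (at t)" for t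
    unfolding DERIV_deriv_iff_real_differentiable differentiable_def
    using Cn_SucD(1)[OF assms, of t] by blast
  have "deriv f = (\<lambda>t. frechet_derivative f (at t) 1)"
  proof
    show "deriv f t = frechet_derivative f (at t) 1" for t
      using frechet_derivative_at[OF *[of t, unfolded has_field_derivative_def]]
      by (metis mult.right_neutral)
  qed
  then show "Cn n (deriv f)" using Cn_SucD(2)[OF assms, of 1] by simp
qed

text \<open>
  The power \<open>t\<^sup>p\<close> cut off by the profile \<open>h\<close> on the scale \<open>c\<close> of \<open>ln t\<close>. If \<open>h\<close> vanishes outside \<open>(-1, 1)\<close>,
  it lives on \<open>e\<^sup>-\<^sup>c < t < e\<^sup>c\<close>. The parameters \<open>h\<close> and \<open>p\<close> are kept general because differentiation
  reproduces the form with \<open>p - 1\<close> and the profile \<open>p h + h'/c\<close>.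
\<close>

definition power_cutoff :: "(real \<Rightarrow> real) \<Rightarrow> real \<Rightarrow> real \<Rightarrow> real \<Rightarrow> real" where
  "power_cutoff h c p t = (if 0 < t then t powr p * h (ln t / c) else 0)"

lemma power_cutoff_near_0:
  assumes "c > 0" "\<And>s. 1 \<le> \<bar>s\<bar> \<Longrightarrow> h s = 0" "t < exp (- c)"
  shows "power_cutoff h c p t = 0"
proof (cases "0 < t")
  case True
  then have "ln t < - c" using assms(3) using ln_less_cancel_iff[OF True, of "exp (- c)"] by simp
  then have "ln t / c \<le> - 1" using assms(1) by (simp add: field_simps)
  then have "1 \<le> \<bar>ln t / c\<bar>" by linarith
  then show ?thesis using assms(2)[of "ln t / c"] by (simp add: power_cutoff_def)
qed (simp add: power_cutoff_def)

lemma power_cutoff_has_real_derivative: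
  assumes c: "c > 0" and h: "\<And>s. 1 \<le> \<bar>s\<bar> \<Longrightarrow> h s = 0"
    and h': "\<And>s. 1 \<le> \<bar>s\<bar> \<Longrightarrow> h' s = 0"
    and d: "\<And>s. (h has_real_derivative h' s) (at s)"
  shows "(power_cutoff h c p has_real_derivative
           power_cutoff (\<lambda>s. p * h s + h' s / c) c (p - 1) t) (at t)"
proof (cases "t < exp (- c)")
  case True
  have "((\<lambda>t. 0) has_real_derivative 0) (at t)" by simp
  then have "(power_cutoff h c p has_real_derivative 0) (at t)"
    by (rule has_field_derivative_transform_within_open[of _ _ _ "{..<exp (- c)}"])
       (use True power_cutoff_near_0[of c h, OF c h] in auto)
  then show ?thesis
    using power_cutoff_near_0[of c "\<lambda>s. p * h s + h' s / c", OF c _ True] h h' by simp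
next
  case False
  then have t: "t > 0" using exp_gt_zero[of "-c"] by linarith
  have "((\<lambda>t. h (ln t / c)) has_real_derivative h' (ln t / c) * (1 / t / c)) (at t)"
    by (rule DERIV_chain2[OF d]) (use t c in \<open>auto intro!: derivative_eq_intros\<close>)
  moreover have "((\<lambda>t. t powr p) has_real_derivative p * t powr (p - 1)) (at t)"
    using t by (rule has_real_derivative_powr)
  ultimately have "((\<lambda>t. t powr p * h (ln t / c)) has_real_derivative
      p * t powr (p - 1) * h (ln t / c) + h' (ln t / c) * (1 / t / c) * t powr p) (at t)"
    by (rule DERIV_mult[rotated])
  moreover have "p * t powr (p - 1) * h (ln t / c) + h' (ln t / c) * (1 / t / c) * t powr p
      = power_cutoff (\<lambda>s. p * h s + h' s / c) c (p - 1) t"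
    using t c by (simp add: power_cutoff_def powr_diff field_simps)
  ultimately have "((\<lambda>t. t powr p * h (ln t / c)) has_real_derivative
      power_cutoff (\<lambda>s. p * h s + h' s / c) c (p - 1) t) (at t)" by simp
  then show ?thesis
    by (rule has_field_derivative_transform_within_open[of _ _ _ "{0<..}"])
       (use t in \<open>auto simp: power_cutoff_def\<close>)
qed

lemma deriv_eq_0_outside:
  fixes h :: "real \<Rightarrow> real"
  assumes "Cn (Suc n) h" "\<And>s. 1 \<le> \<bar>s\<bar> \<Longrightarrow> h s = 0" "1 \<le> \<bar>s\<bar>"
  shows "deriv h s = 0"
proof -
  have out: "deriv h r = 0" if "1 < \<bar>r\<bar>" for r
  proof -
    have "((\<lambda>t. 0) has_real_derivative 0) (at r)" by simp
    then have "(h has_real_derivative 0) (at r)"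
      by (rule has_field_derivative_transform_within_open[of _ _ _ "- {-1..1}"])
         (use that assms(2) in \<open>auto simp: abs_if split: if_splits\<close>)
    then show ?thesis by (rule DERIV_imp_deriv)
  qed
  \<comment> \<open>By continuity the derivative vanishes at the end points as well.\<close>
  have "(\<lambda>j. deriv h (s + sgn s / real (Suc j))) \<longlonglongrightarrow> deriv h (s + sgn s * 0)"
  proof (rule isCont_tendsto_compose[of _ "deriv h"])
    show "isCont (deriv h) (s + sgn s * 0)"
      using Cn_continuous[OF deriv_Cn_real(2)[OF assms(1)]] by (simp add: continuous_on_eq_continuous_at)
    show "(\<lambda>j. s + sgn s / real (Suc j)) \<longlonglongrightarrow> s + sgn s * 0"
      using tendsto_add[OF tendsto_const tendsto_mult[OF tendsto_const LIMSEQ_inverse_real_of_nat]]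
      by (simp add: divide_inverse)
  qed
  moreover have "deriv h (s + sgn s / real (Suc j)) = 0" for j
  proof (rule out)
    define e where "e = 1 / real (Suc j)"
    have "0 < e" by (simp add: e_def)
    moreover have "s + sgn s / real (Suc j) = (if s \<ge> 0 then s + e else s - e)"
      using assms(3) by (auto simp: sgn_if e_def)
    ultimately show "1 < \<bar>s + sgn s / real (Suc j)\<bar>"
      using assms(3) by (auto simp: abs_if split: if_splits)
  qed
  ultimately show ?thesis by (simp add: LIMSEQ_const_iff)
qed

lemma Cn_power_cutoff:
  assumes "c > 0" "\<And>n. Cn n h" "\<And>s. 1 \<le> \<bar>s\<bar> \<Longrightarrow> h s = 0"
  shows "Cn n (power_cutoff h c p)"
  using assms(2,3)
proof (induction n arbitrary: h p)
  case 0
  have d: "(power_cutoff h c p has_real_derivative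
      power_cutoff (\<lambda>s. p * h s + deriv h s / c) c (p - 1) t) (at t)" for t
    by (rule power_cutoff_has_real_derivative[OF assms(1) 0(2)
        deriv_eq_0_outside[OF 0(1) 0(2)] deriv_Cn_real(1)[OF 0(1)]])
  show ?case
    using DERIV_continuous[OF d] by (simp add: continuous_on_eq_continuous_at)
next
  case (Suc n)
  have d: "(power_cutoff h c p has_real_derivative
      power_cutoff (\<lambda>s. p * h s + deriv h s / c) c (p - 1) t) (at t)" for t
    by (rule power_cutoff_has_real_derivative[OF assms(1) Suc.prems(2)
        deriv_eq_0_outside[OF Suc.prems(1) Suc.prems(2)] deriv_Cn_real(1)[OF Suc.prems(1)]])
  have "Cn j (\<lambda>s. p * h s + (1 / c) * deriv h s)" for j
    by (intro Cn_add Cn_mult Cn_const Suc.prems(1) deriv_Cn_real(2)[OF Suc.prems(1)])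
  then have "Cn n (power_cutoff (\<lambda>s. p * h s + deriv h s / c) c (p - 1))"
    using Suc.prems(2) deriv_eq_0_outside[OF Suc.prems(1) Suc.prems(2)] by (intro Suc.IH) auto
  then show ?case by (rule Cn_SucI_real[OF d])
qed

section \<open>Dilations and integrals of homogeneous functions\<close>

text \<open>
  The flow of the linear vector field \<open>(y, \<epsilon> x)\<close>: \<open>\<epsilon> = 0\<close> dilates \<open>y\<close> alone, \<open>\<epsilon> = 1\<close> dilates \<open>z\<close>.
\<close>

definition dilation :: "real \<Rightarrow> real \<Rightarrow> 'a::euclidean_space \<times> 'b::euclidean_space \<Rightarrow> 'a \<times> 'b" where
  "dilation \<epsilon> t z = (exp t *\<^sub>R fst z, exp (\<epsilon> * t) *\<^sub>R snd z)"

lemma continuous_dilation [continuous_intros]: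
  "continuous_on S (dilation \<epsilon> t)"
  unfolding dilation_def[abs_def] by (intro continuous_intros)

lemma measurable_dilation [measurable]: "dilation \<epsilon> t \<in> borel_measurable borel"
  by (intro borel_measurable_continuous_onI continuous_intros)

lemma lborel_dilation:
  "(lborel :: ('a::euclidean_space \<times> 'b::euclidean_space) measure)
     = density (distr lborel borel (dilation \<epsilon> t))
         (\<lambda>_. ennreal (exp ((real DIM('a) + \<epsilon> * real DIM('b)) * t)))"
proof -
  define c :: "'a \<times> 'b \<Rightarrow> real" where "c j = (if snd j = 0 then exp t else exp (\<epsilon> * t))" for j
  have inj: "inj_on (\<lambda>i::'a. (i, 0::'b)) Basis" "inj_on (\<lambda>j::'b. (0::'a, j)) Basis"
    by (auto simp: inj_on_def)
  have disj: "(\<lambda>i::'a. (i, 0::'b)) ` Basis \<inter> (\<lambda>j::'b. (0::'a, j)) ` Basis = {}"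
    by auto
  have T: "dilation \<epsilon> t = (\<lambda>z. 0 + (\<Sum>j\<in>Basis. (c j * (z \<bullet> j)) *\<^sub>R j))"
  proof
    fix z :: "'a \<times> 'b"
    have "(\<Sum>j\<in>Basis. (c j * (z \<bullet> j)) *\<^sub>R j)
        = (\<Sum>i\<in>Basis. (exp t * (fst z \<bullet> i)) *\<^sub>R (i, 0::'b))
          + (\<Sum>j\<in>Basis. (exp (\<epsilon> * t) * (snd z \<bullet> j)) *\<^sub>R (0::'a, j))"
      unfolding Basis_prod_def
      by (subst sum.union_disjoint)
         (auto simp: disj sum.reindex[OF inj(1)] sum.reindex[OF inj(2)] c_def inner_prod_def
           intro!: sum.cong arg_cong2[where f="(+)"])
    also have "\<dots> = (\<Sum>i\<in>Basis. (exp t * (fst z \<bullet> i)) *\<^sub>R i, \<Sum>j\<in>Basis. (exp (\<epsilon> * t) * (snd z \<bullet> j)) *\<^sub>R j)"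
      by (simp add: prod_eq_iff fst_sum snd_sum)
    also have "\<dots> = dilation \<epsilon> t z"
      unfolding scaleR_scaleR[symmetric] scaleR_sum_right[symmetric] euclidean_representation
      by (simp add: dilation_def)
    finally show "dilation \<epsilon> t z = 0 + (\<Sum>j\<in>Basis. (c j * (z \<bullet> j)) *\<^sub>R j)" by simp
  qed
  have "(\<Prod>j\<in>Basis. \<bar>c j\<bar>) = exp t ^ DIM('a) * exp (\<epsilon> * t) ^ DIM('b)"
    unfolding Basis_prod_def
    by (subst prod.union_disjoint)
       (auto simp: disj prod.reindex[OF inj(1)] prod.reindex[OF inj(2)] c_def nonzero_Basis
          intro!: arg_cong2[where f="(*)"])
  also have "\<dots> = exp ((real DIM('a) + \<epsilon> * real DIM('b)) * t)"
    by (simp add: exp_of_nat_mult[symmetric] exp_add[symmetric] algebra_simps)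
  finally have P: "(\<Prod>j\<in>Basis. \<bar>c j\<bar>) = exp ((real DIM('a) + \<epsilon> * real DIM('b)) * t)" .
  show ?thesis
    unfolding T P[symmetric]
    by (rule lborel_affine_euclidean) (simp add: c_def)
qed

lemma nn_integral_dilation:
  fixes f :: "'a::euclidean_space \<times> 'b::euclidean_space \<Rightarrow> ennreal"
  assumes [measurable]: "f \<in> borel_measurable borel"
  shows "(\<integral>\<^sup>+z. f z \<partial>lborel)
    = ennreal (exp ((real DIM('a) + \<epsilon> * real DIM('b)) * t)) * (\<integral>\<^sup>+z. f (dilation \<epsilon> t z) \<partial>lborel)"
  by (subst lborel_dilation[of \<epsilon> t]) (simp add: nn_integral_density nn_integral_distr nn_integral_cmult)

lemma integral_dilation:
  fixes f :: "'a::euclidean_space \<times> 'b::euclidean_space \<Rightarrow> real"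
  assumes [measurable]: "f \<in> borel_measurable borel"
  shows "(\<integral>z. f z \<partial>lborel)
    = exp ((real DIM('a) + \<epsilon> * real DIM('b)) * t) * (\<integral>z. f (dilation \<epsilon> t z) \<partial>lborel)"
  by (subst lborel_dilation[of \<epsilon> t]) (simp add: integral_density integral_distr)

lemma integrable_dilation:
  fixes f :: "'a::euclidean_space \<times> 'b::euclidean_space \<Rightarrow> real"
  assumes "integrable lborel f"
  shows "integrable lborel (\<lambda>z. f (dilation \<epsilon> t z))"
proof -
  have [measurable]: "f \<in> borel_measurable borel" using assms by simp
  show ?thesis
    using assms unfolding integrable_iff_bounded
    by (subst (asm) nn_integral_dilation[of _ \<epsilon> t]) (auto simp: ennreal_mult_less_top)
qed

lemma nn_integral_scale:
  fixes f :: "'a::euclidean_space \<Rightarrow> ennreal"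
  assumes [measurable]: "f \<in> borel_measurable borel"
  shows "(\<integral>\<^sup>+z. f z \<partial>lborel) = ennreal (exp (real DIM('a) * t)) * (\<integral>\<^sup>+z. f (exp t *\<^sub>R z) \<partial>lborel)"
proof -
  have "(\<integral>\<^sup>+z. f z \<partial>lborel) = ennreal (\<bar>exp t\<bar> ^ DIM('a)) * (\<integral>\<^sup>+z. f (0 + exp t *\<^sub>R z) \<partial>lborel)"
    by (subst lborel_affine[of "exp t" 0])
       (simp_all add: nn_integral_density nn_integral_distr nn_integral_cmult)
  then show ?thesis by (simp add: exp_of_nat_mult)
qed

text \<open>
  Polar coordinates without a surface measure: a function \<open>g\<close> homogeneous of minus the dimension induces a
  translation invariant measure in the variable \<open>ln |z|\<close>, hence a multiple of Lebesgue measure, and the factor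
  is the integral of \<open>g\<close> over the shell \<open>1 \<le> |z| < e\<close>. The proof averages over dilations by \<open>e\<^sup>t\<close>, using that
  the indicator of \<open>[0, 1)\<close> has integral one, and exchanges the two integrals.
\<close>

lemma nn_integral_log_polar:
  fixes g :: "'a::euclidean_space \<Rightarrow> ennreal" and h :: "real \<Rightarrow> ennreal"
  assumes [measurable]: "g \<in> borel_measurable borel" "h \<in> borel_measurable borel"
    and g0: "g 0 = 0"
    and hom: "\<And>t z. ennreal (exp (real DIM('a) * t)) * g (exp t *\<^sub>R z) = g z"
  shows "(\<integral>\<^sup>+z. h (ln (norm z)) * g z \<partial>lborel)
    = (\<integral>\<^sup>+t. h t \<partial>lborel) * (\<integral>\<^sup>+z. g z * indicator {0..<1} (ln (norm z)) \<partial>lborel)"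
proof -
  let ?I = "indicator {0..<1::real} :: real \<Rightarrow> ennreal"
  have one: "(\<integral>\<^sup>+t. ?I (s - t) \<partial>lborel) = 1" for s
  proof -
    have "?I (s - t) = indicator {s - 1<..s} t" for t by (auto simp: indicator_def)
    then show ?thesis by simp
  qed
  have "(\<integral>\<^sup>+z. h (ln (norm z)) * g z \<partial>lborel)
      = (\<integral>\<^sup>+z. (\<integral>\<^sup>+t. h (ln (norm z)) * g z * ?I (ln (norm z) - t) \<partial>lborel) \<partial>lborel)"
    by (subst nn_integral_cmult) (simp_all add: one)
  also have "\<dots> = (\<integral>\<^sup>+t. (\<integral>\<^sup>+z. h (ln (norm z)) * g z * ?I (ln (norm z) - t) \<partial>lborel) \<partial>lborel)"
    by (rule lborel_pair.Fubini') measurable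
  also have "\<dots> = (\<integral>\<^sup>+t. (\<integral>\<^sup>+z. h (t + ln (norm z)) * g z * ?I (ln (norm z)) \<partial>lborel) \<partial>lborel)"
  proof (rule nn_integral_cong)
    fix t :: real
    have "(\<integral>\<^sup>+z. h (ln (norm z)) * g z * ?I (ln (norm z) - t) \<partial>lborel)
      = (\<integral>\<^sup>+z. ennreal (exp (real DIM('a) * t)) *
          (h (ln (norm (exp t *\<^sub>R z))) * g (exp t *\<^sub>R z) * ?I (ln (norm (exp t *\<^sub>R z)) - t)) \<partial>lborel)"
      by (subst nn_integral_scale[of _ t]) (auto simp: nn_integral_cmult)
    also have "\<dots> = (\<integral>\<^sup>+z. h (t + ln (norm z)) * g z * ?I (ln (norm z)) \<partial>lborel)"
    proof (rule nn_integral_cong)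
      fix z :: 'a
      show "ennreal (exp (real DIM('a) * t)) *
          (h (ln (norm (exp t *\<^sub>R z))) * g (exp t *\<^sub>R z) * ?I (ln (norm (exp t *\<^sub>R z)) - t))
          = h (t + ln (norm z)) * g z * ?I (ln (norm z))"
      proof (cases "z = 0")
        case False
        then have "ln (norm (exp t *\<^sub>R z)) = t + ln (norm z)"
          by (simp add: ln_mult)
        then show ?thesis
          by (simp add: hom[of t z, symmetric] mult_ac)
      qed (simp add: g0)
    qed
    finally show "(\<integral>\<^sup>+z. h (ln (norm z)) * g z * ?I (ln (norm z) - t) \<partial>lborel)
      = (\<integral>\<^sup>+z. h (t + ln (norm z)) * g z * ?I (ln (norm z)) \<partial>lborel)" .
  qed
  also have "\<dots> = (\<integral>\<^sup>+z. (\<integral>\<^sup>+t. h (t + ln (norm z)) * (g z * ?I (ln (norm z))) \<partial>lborel) \<partial>lborel)"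
    unfolding mult.assoc by (rule lborel_pair.Fubini') measurable
  also have "\<dots> = (\<integral>\<^sup>+z. (\<integral>\<^sup>+t. h t \<partial>lborel) * (g z * ?I (ln (norm z))) \<partial>lborel)"
  proof (rule nn_integral_cong)
    fix z :: 'a
    have "(\<integral>\<^sup>+t. h t \<partial>lborel) = (\<integral>\<^sup>+t. h (ln (norm z) + 1 * t) \<partial>lborel)"
      by (subst nn_integral_real_affine[of h 1 "ln (norm z)"]) auto
    then show "(\<integral>\<^sup>+t. h (t + ln (norm z)) * (g z * ?I (ln (norm z))) \<partial>lborel)
       = (\<integral>\<^sup>+t. h t \<partial>lborel) * (g z * ?I (ln (norm z)))"
      by (subst nn_integral_multc) (simp_all add: add.commute)
  qed
  also have "\<dots> = (\<integral>\<^sup>+t. h t \<partial>lborel) * (\<integral>\<^sup>+z. g z * ?I (ln (norm z)) \<partial>lborel)"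
    by (subst nn_integral_cmult) auto
  finally show ?thesis .
qed

lemma nn_integral_exp_atMost:
  assumes "(c::real) > 0"
  shows "(\<integral>\<^sup>+t. ennreal (exp (c * t)) * indicator {..r} t \<partial>lborel) = ennreal (exp (c * r) / c)"
proof -
  have lim: "((\<lambda>x. - exp (- c * x) / c) \<longlongrightarrow> 0) at_top"
    using assms by real_asymp
  have "(\<integral>\<^sup>+t. ennreal (exp (c * t)) * indicator {..r} t \<partial>lborel)
      = (\<integral>\<^sup>+t. ennreal (exp (- c * t)) * indicator {- r..} t \<partial>lborel)"
    by (subst nn_integral_real_affine[where c = "-1" and t = 0])
       (auto intro!: nn_integral_cong simp: indicator_def)
  also have "\<dots> = 0 - (- exp (- c * (- r)) / c)"
    by (rule nn_integral_FTC_atLeast[OF _ _ _ lim])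
       (use assms in \<open>auto intro!: derivative_eq_intros\<close>)
  finally show ?thesis by simp
qed

section \<open>Integrability of the weights\<close>

text \<open>
  Because \<open>0 powr p = 0\<close> the weight vanishes on \<open>{y = 0}\<close> for all exponents. Pointwise statements about
  weighted quantities therefore only have to be checked where \<open>y \<noteq> 0\<close>, and there \<open>z \<noteq> 0\<close> too.
\<close>

definition weight :: "real \<Rightarrow> real \<Rightarrow> 'a::euclidean_space \<times> 'b::euclidean_space \<Rightarrow> real" where
  "weight p q z = norm (fst z) powr p * norm z powr q"

lemma measurable_weight [measurable]: "weight p q \<in> borel_measurable borel"
proof -
  have [measurable]: "(fst :: 'a \<times> 'b \<Rightarrow> 'a) \<in> borel_measurable borel"
    by (intro borel_measurable_continuous_onI continuous_intros)
  show ?thesis unfolding weight_def[abs_def] by measurable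
qed

lemma weight_nonneg [simp]: "0 \<le> weight p q z"
  by (simp add: weight_def)

lemma weight_eq_0 [simp]: "fst z = 0 \<Longrightarrow> weight p q z = 0"
  by (simp add: weight_def)

lemma weight_pos: "fst z \<noteq> 0 \<Longrightarrow> 0 < weight p q z"
  unfolding weight_def by (rule mult_pos_pos) auto

lemma weight_mult: "weight p q z * weight p' q' z = weight (p + p') (q + q') z"
  by (simp add: weight_def powr_add)

lemma weight_square: "(weight p q z)\<^sup>2 = weight (2 * p) (2 * q) z"
  by (simp only: power2_eq_square weight_mult mult_2)

lemma weight_scale: "weight p q (exp t *\<^sub>R z) = exp ((p + q) * t) * weight p q z"
  by (simp add: weight_def powr_def exp_add[symmetric] ln_mult algebra_simps)

lemma norm_le_exp: "z \<noteq> 0 \<Longrightarrow> ln (norm z) \<le> r \<Longrightarrow> norm z \<le> exp r"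
  using exp_le_cancel_iff[of "ln (norm z)" r] by simp

lemma norm_powr_ball_finite:
  assumes "real DIM('a::euclidean_space) + p > 0"
  shows "(\<integral>\<^sup>+(y::'a). ennreal (norm y powr p) * indicator {..r} (ln (norm y)) \<partial>lborel) < \<infinity>"
proof -
  let ?g = "\<lambda>y::'a. ennreal (norm y powr (- real DIM('a)))"
  let ?h = "\<lambda>t. ennreal (exp ((real DIM('a) + p) * t)) * indicator {..r} t"
  have "ennreal (norm y powr p) * indicator {..r} (ln (norm y)) = ?h (ln (norm y)) * ?g y" for y :: 'a
    by (cases "y = 0")
       (auto simp: powr_def indicator_def ennreal_mult[symmetric] exp_add[symmetric] algebra_simps)
  then have "(\<integral>\<^sup>+(y::'a). ennreal (norm y powr p) * indicator {..r} (ln (norm y)) \<partial>lborel)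
      = (\<integral>\<^sup>+(y::'a). ?h (ln (norm y)) * ?g y \<partial>lborel)" by simp
  also have "\<dots> = (\<integral>\<^sup>+t. ?h t \<partial>lborel) * (\<integral>\<^sup>+y. ?g y * indicator {0..<1} (ln (norm y)) \<partial>lborel)"
  proof (rule nn_integral_log_polar)
    fix t and y :: 'a
    show "ennreal (exp (real DIM('a) * t)) * ?g (exp t *\<^sub>R y) = ?g y"
      by (simp add: powr_def ln_mult ennreal_mult[symmetric] exp_add[symmetric] algebra_simps)
  qed auto
  also have "\<dots> < \<infinity>"
  proof -
    have "(\<integral>\<^sup>+y. ?g y * indicator {0..<1} (ln (norm y)) \<partial>lborel)
        \<le> (\<integral>\<^sup>+(y::'a). indicator (cball 0 (exp 1)) y \<partial>lborel)"
    proof (rule nn_integral_mono)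
      fix y :: 'a
      have "norm y powr (- real DIM('a)) \<le> 1 \<and> norm y \<le> exp 1"
        if "y \<noteq> 0" "0 \<le> ln (norm y)" "ln (norm y) < 1"
      proof
        show "norm y powr (- real DIM('a)) \<le> 1" using that by (simp add: powr_def)
        show "norm y \<le> exp 1" using that by (intro norm_le_exp) auto
      qed
      then show "?g y * indicator {0..<1} (ln (norm y)) \<le> indicator (cball 0 (exp 1)) y"
        by (cases "y = 0") (auto simp: indicator_def ennreal_le_1)
    qed
    also have "\<dots> < \<infinity>" 
      using emeasure_bounded_finite[OF bounded_cball, of "0 :: 'a" "exp 1"] by simp
    finally show ?thesis
      by (simp add: nn_integral_exp_atMost[OF assms] ennreal_mult_less_top)
  qed
  finally show ?thesis .
qed

text \<open>
  On the shell \<open>|z|\<^sup>q\<close> is bounded and both \<open>|y|\<close> and \<open>|x|\<close> are at most \<open>e\<close>, so Tonelli's theorem leaves the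
  integral of \<open>|y|\<^sup>p\<close> over a ball.
\<close>

lemma weight_shell_finite:
  fixes p q :: real
  assumes "real DIM('a::euclidean_space) + p > 0"
  shows "(\<integral>\<^sup>+(z::'a \<times> 'b::euclidean_space).
            ennreal (weight p q z) * indicator {0..<1} (ln (norm z)) \<partial>lborel) < \<infinity>"
proof -
  let ?f = "\<lambda>y::'a. ennreal (norm y powr p) * indicator {..1} (ln (norm y))"
  have [measurable]: "cball (0::'b) (exp 1) \<in> sets borel" by simp
  have M: "(\<lambda>z::'a \<times> 'b. ?f (fst z) * indicator (cball 0 (exp 1)) (snd z))
      \<in> borel_measurable (lborel \<Otimes>\<^sub>M lborel)"
    by measurable
  have "(\<integral>\<^sup>+(z::'a \<times> 'b). ennreal (weight p q z) * indicator {0..<1} (ln (norm z)) \<partial>lborel)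
      \<le> (\<integral>\<^sup>+(z::'a \<times> 'b). ennreal (exp \<bar>q\<bar>) * (?f (fst z) * indicator (cball 0 (exp 1)) (snd z)) \<partial>lborel)"
  proof (rule nn_integral_mono)
    fix z :: "'a \<times> 'b"
    show "ennreal (weight p q z) * indicator {0..<1} (ln (norm z))
        \<le> ennreal (exp \<bar>q\<bar>) * (?f (fst z) * indicator (cball 0 (exp 1)) (snd z))"
    proof (cases "fst z \<noteq> 0 \<and> ln (norm z) \<in> {0..<1}")
      case True
      then have z: "z \<noteq> 0" by auto
      have n: "norm z \<le> exp 1"
        using True z by (intro norm_le_exp) auto
      have f: "norm (fst z) \<le> exp 1" and s: "norm (snd z) \<le> exp 1"
        using n norm_fst_le[of "fst z" "snd z"] norm_snd_le[of "snd z" "fst z"] by simp_all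
      have lf: "ln (norm (fst z)) \<le> 1"
        using ln_le_cancel_iff[of "norm (fst z)" "exp 1"] f True by simp
      have "q * ln (norm z) \<le> \<bar>q\<bar> * ln (norm z)"
        using True by (intro mult_right_mono) auto
      also have "\<dots> \<le> \<bar>q\<bar>"
        using True mult_left_le[of "ln (norm z)" "\<bar>q\<bar>"] by simp
      finally have "q * ln (norm z) \<le> \<bar>q\<bar>" .
      then have "norm z powr q \<le> exp \<bar>q\<bar>"
        using z by (simp add: powr_def)
      then have "weight p q z \<le> exp \<bar>q\<bar> * norm (fst z) powr p"
        unfolding weight_def by (subst mult.commute) (rule mult_right_mono, simp_all)
      then show ?thesis
        using True lf s by (simp add: ennreal_mult[symmetric] ennreal_leI)
    next
      case False
      then have "ennreal (weight p q z) * indicator {0..<1} (ln (norm z)) = 0"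
        by (auto simp: indicator_def)
      then show ?thesis by (simp only: zero_le)
    qed
  qed
  also have "\<dots> = ennreal (exp \<bar>q\<bar>) *
      (\<integral>\<^sup>+(z::'a \<times> 'b). ?f (fst z) * indicator (cball 0 (exp 1)) (snd z) \<partial>lborel)"
    using M unfolding lborel_prod by (rule nn_integral_cmult)
  also have "\<dots> < \<infinity>"
  proof -
    have "(\<integral>\<^sup>+(z::'a \<times> 'b). ?f (fst z) * indicator (cball 0 (exp 1)) (snd z) \<partial>lborel)
        = (\<integral>\<^sup>+y. (\<integral>\<^sup>+(x::'b). ?f y * indicator (cball 0 (exp 1)) x \<partial>lborel) \<partial>lborel)"
      unfolding lborel_prod[symmetric, where 'a='a and 'b='b]
      by (subst lborel.nn_integral_fst[OF M, symmetric]) simp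
    also have "\<dots> = (\<integral>\<^sup>+y. ?f y \<partial>lborel) * emeasure lborel (cball (0::'b) (exp 1))"
      by (simp add: nn_integral_cmult nn_integral_multc)
    also have "\<dots> < \<infinity>"
      using norm_powr_ball_finite[OF assms, of 1] emeasure_bounded_finite[OF bounded_cball, of "0::'b" "exp 1"]
      by (simp add: ennreal_mult_less_top)
    finally show ?thesis by (simp add: ennreal_mult_less_top)
  qed
  finally show ?thesis .
qed

text \<open>
  The restriction to a cone \<open>A\<close> preserves homogeneity; it serves to bound the mass of the test functions from
  below.
\<close>

lemma weight_log_polar:
  fixes h :: "real \<Rightarrow> ennreal" and p q :: real and A :: "('a::euclidean_space \<times> 'b::euclidean_space) set"
  assumes [measurable]: "h \<in> borel_measurable borel" "A \<in> sets borel"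
    and A: "\<And>t z. exp t *\<^sub>R z \<in> A \<longleftrightarrow> z \<in> A"
    and pq: "p + q = - real DIM('a) - real DIM('b)"
  shows "(\<integral>\<^sup>+z. h (ln (norm z)) * (ennreal (weight p q z) * indicator A z) \<partial>lborel)
    = (\<integral>\<^sup>+t. h t \<partial>lborel)
        * (\<integral>\<^sup>+z. ennreal (weight p q z) * indicator A z * indicator {0..<1} (ln (norm z)) \<partial>lborel)"
proof (rule nn_integral_log_polar)
  fix t and z :: "'a \<times> 'b"
  have "exp (real DIM('a \<times> 'b) * t) * exp ((p + q) * t) = 1"
    by (simp add: pq exp_add[symmetric] algebra_simps)
  then have "exp (real DIM('a \<times> 'b) * t) * weight p q (exp t *\<^sub>R z) = weight p q z"
    unfolding weight_scale mult.assoc[symmetric] by simp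
  then show "ennreal (exp (real DIM('a \<times> 'b) * t)) *
      (ennreal (weight p q (exp t *\<^sub>R z)) * indicator A (exp t *\<^sub>R z))
      = ennreal (weight p q z) * indicator A z"
    by (simp add: mult.assoc[symmetric] ennreal_mult[symmetric] A indicator_def)
qed auto

text \<open>
  The two conditions are those for integrability at \<open>{y = 0}\<close> and at the origin. The second one enters through
  the factor \<open>exp ((d + p + q) t)\<close> that is left for the variable \<open>t = ln |z|\<close>.
\<close>

lemma weight_ball_finite:
  fixes p q r :: real
  assumes p: "real DIM('a::euclidean_space) + p > 0"
    and pq: "real DIM('a) + real DIM('b::euclidean_space) + p + q > 0"
  shows "(\<integral>\<^sup>+(z::'a \<times> 'b). ennreal (weight p q z) * indicator {..r} (ln (norm z)) \<partial>lborel) < \<infinity>"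
proof -
  define d where "d = real DIM('a) + real DIM('b)"
  let ?h = "\<lambda>t. ennreal (exp ((d + p + q) * t)) * indicator {..r} t"
  have "ennreal (weight p q z) * indicator {..r} (ln (norm z))
      = ?h (ln (norm z)) * (ennreal (weight p (- d - p) z) * indicator UNIV z)" for z :: "'a \<times> 'b"
    by (cases "z = 0")
       (auto simp: weight_def powr_def indicator_def ennreal_mult[symmetric] exp_add[symmetric] algebra_simps)
  then have "(\<integral>\<^sup>+(z::'a \<times> 'b). ennreal (weight p q z) * indicator {..r} (ln (norm z)) \<partial>lborel)
      = (\<integral>\<^sup>+(z::'a \<times> 'b). ?h (ln (norm z)) * (ennreal (weight p (- d - p) z) * indicator UNIV z) \<partial>lborel)"
    by simp
  also have "\<dots> = (\<integral>\<^sup>+t. ?h t \<partial>lborel) * (\<integral>\<^sup>+(z::'a \<times> 'b).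
      ennreal (weight p (- d - p) z) * indicator UNIV z * indicator {0..<1} (ln (norm z)) \<partial>lborel)"
    by (rule weight_log_polar) (auto simp: d_def)
  also have "\<dots> < \<infinity>"
    using weight_shell_finite[OF p, where q = "- d - p" and 'b = 'b] pq
    by (simp add: nn_integral_exp_atMost d_def ennreal_mult_less_top)
  finally show ?thesis .
qed

lemma integrable_weight_mult:
  fixes v :: "'a::euclidean_space \<times> 'b::euclidean_space \<Rightarrow> real"
  assumes p: "real DIM('a) + p > 0" and pq: "real DIM('a) + real DIM('b) + p + q > 0"
    and [measurable]: "v \<in> borel_measurable borel"
    and B: "\<And>z. \<bar>v z\<bar> \<le> B" and r: "\<And>z. v z \<noteq> 0 \<Longrightarrow> norm z \<le> r"
  shows "integrable lborel (\<lambda>z. weight p q z * v z)"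
proof -
  define s where "s = ln (max r 1)"
  have "integrable lborel (\<lambda>z::'a \<times> 'b. B * (weight p q z * indicator {..s} (ln (norm z))))"
  proof (rule integrable_mult_right, rule integrableI_bounded)
    have "(\<integral>\<^sup>+(z::'a \<times> 'b). ennreal (norm (weight p q z * indicator {..s} (ln (norm z)))) \<partial>lborel)
        = (\<integral>\<^sup>+(z::'a \<times> 'b). ennreal (weight p q z) * indicator {..s} (ln (norm z)) \<partial>lborel)"
      by (intro nn_integral_cong) (auto simp: indicator_def)
    then show "(\<integral>\<^sup>+(z::'a \<times> 'b). ennreal (norm (weight p q z * indicator {..s} (ln (norm z)))) \<partial>lborel) < \<infinity>"
      using weight_ball_finite[OF p pq] by simp
  qed simp
  then show ?thesis
  proof (rule Bochner_Integration.integrable_bound, safe intro!: AE_I2)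
    fix z :: "'a \<times> 'b"
    have B0: "0 \<le> B" using B[of z] by linarith
    show "norm (weight p q z * v z) \<le> norm (B * (weight p q z * indicator {..s} (ln (norm z))))"
    proof (cases "v z = 0 \<or> fst z = 0")
      case False
      then have "z \<noteq> 0" by auto
      then have "ln (norm z) \<le> s"
        unfolding s_def using r[of z] False by (subst ln_le_cancel_iff) auto
      then show ?thesis
        using B[of z] B0 by (simp add: abs_mult mult_right_mono mult.commute[of _ "weight p q z"] mult_left_mono)
    qed auto
  qed simp
qed

section \<open>Gradients of test functions\<close>

lemma GDERIV_unique:
  assumes "GDERIV u z :> D" "GDERIV u z :> D'"
  shows "D = D'"
proof -
  have "(\<lambda>h. h \<bullet> D) = (\<lambda>h. h \<bullet> D')"
    using assms unfolding gderiv_def by (rule has_derivative_unique)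
  then show ?thesis by (metis inner_commute vector_eq_ldot)
qed

lemma grad_eq: "GDERIV u z :> D \<Longrightarrow> grad u z = D"
  unfolding grad_def by (rule the_equality) (simp_all add: GDERIV_unique)

lemma GDERIV_of_has_derivative:
  fixes u :: "'a::euclidean_space \<Rightarrow> real"
  assumes "(u has_derivative u') (at z)"
  shows "GDERIV u z :> (\<Sum>b\<in>Basis. u' b *\<^sub>R b)"
proof -
  have lin: "linear u'" using assms by (rule has_derivative_linear)
  have "u' = (\<lambda>h. h \<bullet> (\<Sum>b\<in>Basis. u' b *\<^sub>R b))"
  proof
    fix h
    have "u' h = u' (\<Sum>b\<in>Basis. (h \<bullet> b) *\<^sub>R b)" by (simp add: euclidean_representation)
    also have "\<dots> = (\<Sum>b\<in>Basis. (h \<bullet> b) * u' b)"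
      by (simp add: linear_sum[OF lin] linear_scale[OF lin])
    finally show "u' h = h \<bullet> (\<Sum>b\<in>Basis. u' b *\<^sub>R b)"
      by (simp add: inner_sum_right mult.commute)
  qed
  then show ?thesis unfolding gderiv_def by (rule has_derivative_eq_rhs[OF assms])
qed

lemma
  assumes "Cn (Suc 0) u"
  shows GDERIV_grad: "GDERIV u z :> grad u z"
    and continuous_grad: "continuous_on UNIV (grad u)"
proof -
  have D: "GDERIV u z :> (\<Sum>b\<in>Basis. frechet_derivative u (at z) b *\<^sub>R b)" for z
    by (rule GDERIV_of_has_derivative[OF Cn_SucD(1)[OF assms]])
  then have eq: "grad u = (\<lambda>z. \<Sum>b\<in>Basis. frechet_derivative u (at z) b *\<^sub>R b)"
    by (intro ext grad_eq)
  show "GDERIV u z :> grad u z" using D unfolding eq .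
  show "continuous_on UNIV (grad u)"
    unfolding eq using Cn_SucD(2)[OF assms] by (intro continuous_intros) simp
qed

lemma grad_eq_0:
  assumes "open S" "z \<in> S" "\<And>z'. z' \<in> S \<Longrightarrow> u z' = 0"
  shows "grad u z = 0"
proof (rule grad_eq)
  have "((\<lambda>_. 0) has_derivative (\<lambda>h. h \<bullet> 0)) (at z)" by simp
  then show "GDERIV u z :> 0"
    unfolding gderiv_def
    by (rule has_derivative_transform_within_open[OF _ assms(1,2)]) (simp add: assms(3))
qed

lemma Cc_infinityD:
  assumes "u \<in> Cc_infinity"
  shows "Cn n u" "continuous_on UNIV u" "continuous_on UNIV (grad u)" "GDERIV u z :> grad u z"
proof -
  show *: "Cn n u" for n using assms by (simp add: Cc_infinity_def)
  show "continuous_on UNIV u" by (rule Cn_continuous[OF *[of 0]])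
  show "continuous_on UNIV (grad u)" "GDERIV u z :> grad u z"
    by (rule continuous_grad[OF *], rule GDERIV_grad[OF *])
qed

lemma Cc_infinity_bounds:
  assumes u: "u \<in> Cc_infinity"
  obtains B r where "\<And>z. \<bar>u z\<bar> \<le> B" "\<And>z. norm (grad u z) \<le> B"
    "\<And>z. r < norm z \<Longrightarrow> u z = 0" "\<And>z. r < norm z \<Longrightarrow> grad u z = 0" "0 \<le> B"
proof -
  define K where "K = closure {z. u z \<noteq> 0}"
  have K: "compact K" using u by (simp add: Cc_infinity_def K_def)
  have u0: "u z = 0" if "z \<notin> K" for z
    using that closure_subset[THEN subsetD, of z "{z. u z \<noteq> 0}"] unfolding K_def by auto
  have g0: "grad u z = 0" if "z \<notin> K" for z
  proof (rule grad_eq_0)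
    show "open (- K)" unfolding K_def by (rule open_Compl) simp
  qed (use that u0 in simp_all)
  obtain r where r: "\<And>z. z \<in> K \<Longrightarrow> norm z \<le> r"
    using compact_imp_bounded[OF K] by (auto simp: bounded_iff)
  have "bounded (u ` K)"
    by (intro compact_imp_bounded compact_continuous_image K
        continuous_on_subset[OF Cc_infinityD(2)[OF u]]) simp
  then obtain B1 where B1: "\<And>z. z \<in> K \<Longrightarrow> \<bar>u z\<bar> \<le> B1"
    unfolding bounded_iff by auto
  have "bounded (grad u ` K)"
    by (intro compact_imp_bounded compact_continuous_image K
        continuous_on_subset[OF Cc_infinityD(3)[OF u]]) simp
  then obtain B2 where B2: "\<And>z. z \<in> K \<Longrightarrow> norm (grad u z) \<le> B2"
    unfolding bounded_iff by auto
  show thesis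
  proof (rule that[of "max 0 (max B1 B2)" r])
    fix z
    show "\<bar>u z\<bar> \<le> max 0 (max B1 B2)" "norm (grad u z) \<le> max 0 (max B1 B2)"
      using B1[of z] B2[of z] u0[of z] g0[of z] by (cases "z \<in> K"; simp add: le_max_iff_disj)+
    show "r < norm z \<Longrightarrow> u z = 0" "r < norm z \<Longrightarrow> grad u z = 0"
      using r[of z] u0[of z] g0[of z] by (cases "z \<in> K"; simp)+
  qed simp
qed

section \<open>Integration by parts along dilations\<close>

lemma fst_dilation [simp]: "fst (dilation \<epsilon> t z) = exp t *\<^sub>R fst z"
  and snd_dilation [simp]: "snd (dilation \<epsilon> t z) = exp (\<epsilon> * t) *\<^sub>R snd z"
  by (simp_all add: dilation_def)

lemma norm_prod_sq: "(norm z)\<^sup>2 = (norm (fst z))\<^sup>2 + (norm (snd z))\<^sup>2"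
  by (cases z) (simp add: norm_Pair)

lemma dilation_weight_has_derivative:
  fixes z :: "'a::euclidean_space \<times> 'b::euclidean_space" and \<epsilon> :: real
  assumes "fst z \<noteq> 0"
  defines "w \<equiv> \<lambda>t. dilation \<epsilon> t z"
  shows "((\<lambda>t. weight p q (w t)) has_real_derivative
     weight p q (w t) * (p + q * ((norm (fst (w t)))\<^sup>2 + \<epsilon> * (norm (snd (w t)))\<^sup>2) / (norm (w t))\<^sup>2)) (at t)"
proof -
  define N where "N t = exp (2 * t) * (norm (fst z))\<^sup>2 + exp (2 * (\<epsilon> * t)) * (norm (snd z))\<^sup>2" for t
  have N: "N t = (norm (w t))\<^sup>2" for t
    unfolding norm_prod_sq w_def N_def
    by (simp add: power_mult_distrib exp_double)
  have Npos: "N t > 0" for t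
    unfolding N_def using assms(1) by (intro add_pos_nonneg mult_pos_pos) auto
  have weight: "weight p q (w t) = norm (fst z) powr p * (exp (p * t) * N t powr (q / 2))" for t
  proof -
    have "norm (w t) powr q = N t powr (q / 2)"
      using Npos[of t] unfolding N by (simp add: powr_def ln_realpow)
    then show ?thesis
      using assms(1) by (simp add: weight_def w_def powr_def exp_add[symmetric] ln_mult algebra_simps)
  qed
  have dN: "(N has_real_derivative 2 * (exp (2 * t) * (norm (fst z))\<^sup>2 + \<epsilon> * (exp (2 * (\<epsilon> * t)) * (norm (snd z))\<^sup>2))) (at t)"
    unfolding N_def[abs_def] by (auto intro!: derivative_eq_intros simp: algebra_simps)
  have e: "2 * (exp (2 * t) * (norm (fst z))\<^sup>2 + \<epsilon> * (exp (2 * (\<epsilon> * t)) * (norm (snd z))\<^sup>2))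
      = 2 * ((norm (fst (w t)))\<^sup>2 + \<epsilon> * (norm (snd (w t)))\<^sup>2)"
    by (simp add: w_def power_mult_distrib exp_double)
  have dNq: "((\<lambda>t. N t powr (q / 2)) has_real_derivative
      (q / 2 * N t powr (q / 2 - 1)) * (2 * ((norm (fst (w t)))\<^sup>2 + \<epsilon> * (norm (snd (w t)))\<^sup>2))) (at t)"
    by (rule DERIV_chain2[OF has_real_derivative_powr[OF Npos] dN[unfolded e]])
  show ?thesis
    unfolding weight
    by (rule DERIV_cong[OF DERIV_cmult[OF DERIV_mult[OF _ dNq]]], (auto intro!: derivative_eq_intros)[1])
       (use Npos[of t] in \<open>simp add: N[symmetric] powr_diff add_divide_distrib algebra_simps\<close>)
qed

lemma dilation_comp_has_derivative:
  fixes u :: "'a::euclidean_space \<times> 'b::euclidean_space \<Rightarrow> real"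
  assumes "u \<in> Cc_infinity"
  shows "((\<lambda>t. u (dilation \<epsilon> t z)) has_real_derivative
     grad u (dilation \<epsilon> t z) \<bullet> (fst (dilation \<epsilon> t z), \<epsilon> *\<^sub>R snd (dilation \<epsilon> t z))) (at t)"
proof -
  have "((\<lambda>t. dilation \<epsilon> t z) has_derivative
      (\<lambda>h. h *\<^sub>R (fst (dilation \<epsilon> t z), \<epsilon> *\<^sub>R snd (dilation \<epsilon> t z)))) (at t)"
    unfolding dilation_def
    by (auto intro!: derivative_eq_intros simp: algebra_simps)
  note d = has_derivative_compose[OF this Cc_infinityD(4)[OF assms, unfolded gderiv_def]]
  have "(h *\<^sub>R X) \<bullet> G = G \<bullet> X * h" for h X and G :: "'a \<times> 'b"
    by (simp only: inner_scaleR_left inner_commute[of X G] mult.commute)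
  then show ?thesis
    unfolding has_field_derivative_def by (intro has_derivative_eq_rhs[OF d] ext)
qed


text \<open>
  For \<open>X = (y, \<epsilon> x)\<close>, this is \<open>div (|y|\<^sup>p |z|\<^sup>q u\<^sup>2 X)\<close> divided by \<open>|y|\<^sup>p |z|\<^sup>q\<close>.
\<close>

definition dilation_density ::
    "real \<Rightarrow> real \<Rightarrow> real \<Rightarrow> ('a::euclidean_space \<times> 'b::euclidean_space \<Rightarrow> real) \<Rightarrow> 'a \<times> 'b \<Rightarrow> real" where
  "dilation_density p q \<epsilon> u z =
     (real DIM('a) + \<epsilon> * real DIM('b) + p
       + q * ((norm (fst z))\<^sup>2 + \<epsilon> * (norm (snd z))\<^sup>2) / (norm z)\<^sup>2) * (u z)\<^sup>2
     + 2 * u z * (grad u z \<bullet> (fst z, \<epsilon> *\<^sub>R snd z))"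

lemma dilation_weighted_square_has_derivative:
  fixes u :: "'a::euclidean_space \<times> 'b::euclidean_space \<Rightarrow> real" and \<epsilon> :: real
  assumes u: "u \<in> Cc_infinity" and z: "fst z \<noteq> 0"
  defines "\<kappa> \<equiv> real DIM('a) + \<epsilon> * real DIM('b)"
  shows "((\<lambda>t. exp (\<kappa> * t) * (weight p q (dilation \<epsilon> t z) * (u (dilation \<epsilon> t z))\<^sup>2)) has_real_derivative
     exp (\<kappa> * t) * (weight p q (dilation \<epsilon> t z) * dilation_density p q \<epsilon> u (dilation \<epsilon> t z))) (at t)"
proof -
  have e: "((\<lambda>t. exp (\<kappa> * t)) has_real_derivative \<kappa> * exp (\<kappa> * t)) (at t)"
    by (auto intro!: derivative_eq_intros)
  have u2: "((\<lambda>t. (u (dilation \<epsilon> t z))\<^sup>2) has_real_derivative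
      2 * u (dilation \<epsilon> t z) * (grad u (dilation \<epsilon> t z) \<bullet> (fst (dilation \<epsilon> t z), \<epsilon> *\<^sub>R snd (dilation \<epsilon> t z)))) (at t)"
    by (rule DERIV_cong[OF DERIV_power[OF dilation_comp_has_derivative[OF u]]]) simp
  show ?thesis
    by (rule DERIV_cong[OF DERIV_mult[OF e DERIV_mult[OF dilation_weight_has_derivative[OF z] u2]]])
       (simp add: dilation_density_def \<kappa>_def algebra_simps)
qed

lemma continuous_dilation_density:
  fixes u :: "'a::euclidean_space \<times> 'b::euclidean_space \<Rightarrow> real"
  assumes "u \<in> Cc_infinity"
  shows "continuous_on {z. fst z \<noteq> 0} (\<lambda>z. weight p q z * dilation_density p q \<epsilon> u z)"
proof -
  let ?S = "{z :: 'a \<times> 'b. fst z \<noteq> 0}"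
  have u: "continuous_on ?S u" "continuous_on ?S (grad u)"
    using Cc_infinityD(2,3)[OF assms] by (blast intro: continuous_on_subset)+
  have f: "continuous_on ?S (\<lambda>z. norm (fst z))" "continuous_on ?S (\<lambda>z. norm (snd z))"
      "continuous_on ?S norm" "continuous_on ?S (\<lambda>z. (fst z, \<epsilon> *\<^sub>R snd z))"
    by (intro continuous_intros)+
  have weight: "continuous_on ?S (weight p q)"
    unfolding weight_def[abs_def]
    by (intro continuous_on_mult continuous_on_powr f continuous_on_const) (auto simp: zero_prod_def)
  have "continuous_on ?S (dilation_density p q \<epsilon> u)"
    unfolding dilation_density_def[abs_def]
    by (intro continuous_on_mult continuous_on_add continuous_on_divide continuous_on_power
        continuous_on_inner continuous_on_const u f) (auto simp: zero_prod_def)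
  then show ?thesis by (intro continuous_on_mult weight)
qed

lemma borel_measurable_dilation_density:
  fixes u :: "'a::euclidean_space \<times> 'b::euclidean_space \<Rightarrow> real"
  assumes "u \<in> Cc_infinity"
  shows "dilation_density p q \<epsilon> u \<in> borel_measurable borel"
proof -
  have [measurable]: "(fst :: 'a \<times> 'b \<Rightarrow> 'a) \<in> borel_measurable borel"
      "(snd :: 'a \<times> 'b \<Rightarrow> 'b) \<in> borel_measurable borel"
      "u \<in> borel_measurable borel"
      "(\<lambda>z. grad u z \<bullet> (fst z, \<epsilon> *\<^sub>R snd z)) \<in> borel_measurable borel"
    using Cc_infinityD(2,3)[OF assms] by (intro borel_measurable_continuous_onI continuous_intros; simp)+
  show ?thesis unfolding dilation_density_def[abs_def] by measurable
qed

text \<open>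
  The divergence theorem for the field \<open>|y|\<^sup>p |z|\<^sup>q u\<^sup>2 (y, \<epsilon> x)\<close>, read off from the flow. Let \<open>f\<close> be the
  weighted square of \<open>u\<close> and \<open>g\<close> the divergence. Along the flow, \<open>e\<^sup>\<kappa>\<^sup>t f\<close> has derivative \<open>e\<^sup>\<kappa>\<^sup>t g\<close>, where \<open>\<kappa>\<close> is
  the divergence of the generator. Integrating over \<open>0 \<le> t \<le> 1\<close> and over space in both orders, the invariance
  of the integral gives \<open>\<integral> g = \<integral> f - \<integral> f = 0\<close>. The two conditions on \<open>p\<close> and \<open>q\<close> make \<open>f\<close> and \<open>g\<close>
  integrable, and points with \<open>y \<noteq> 0\<close> stay in \<open>{y \<noteq> 0}\<close>, where \<open>g\<close> is continuous along orbits.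
\<close>

lemma weighted_dilation_identity:
  fixes u :: "'a::euclidean_space \<times> 'b::euclidean_space \<Rightarrow> real"
  assumes u: "u \<in> Cc_infinity" and \<epsilon>: "0 \<le> \<epsilon>" "\<epsilon> \<le> 1"
    and p: "real DIM('a) + p > 0" and pq: "real DIM('a) + real DIM('b) + p + q > 0"
  shows "integrable lborel (\<lambda>z. weight p q z * dilation_density p q \<epsilon> u z)"
    and "(\<integral>z. weight p q z * dilation_density p q \<epsilon> u z \<partial>lborel) = 0"
proof -
  define \<kappa> where "\<kappa> = real DIM('a) + \<epsilon> * real DIM('b)"
  define f where "f z = weight p q z * (u z)\<^sup>2" for z
  define g where "g z = weight p q z * dilation_density p q \<epsilon> u z" for z
  obtain B r where B: "\<And>z. \<bar>u z\<bar> \<le> B" "\<And>z. norm (grad u z) \<le> B"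
    "\<And>z. r < norm z \<Longrightarrow> u z = 0" "0 \<le> B"
    using Cc_infinity_bounds[OF u] by metis
  have r: "u z \<noteq> 0 \<Longrightarrow> norm z \<le> r" for z using B(3)[of z] by linarith
  have [measurable]: "u \<in> borel_measurable borel" "dilation_density p q \<epsilon> u \<in> borel_measurable borel"
    using Cc_infinityD(2)[OF u] borel_measurable_dilation_density[OF u]
    by (auto intro: borel_measurable_continuous_onI)
  have u2: "(u z)\<^sup>2 \<le> B\<^sup>2" for z using B(1)[of z] by (simp add: abs_le_square_iff[symmetric] B(4))
  have f: "integrable lborel f"
    unfolding f_def[abs_def]
    by (rule integrable_weight_mult[OF p pq, where B = "B\<^sup>2" and r = r]) (use u2 r in auto)
  have dens: "\<bar>dilation_density p q \<epsilon> u z\<bar> \<le> (\<bar>\<kappa> + p\<bar> + \<bar>q\<bar>) * B\<^sup>2 + 2 * B * (B * \<bar>r\<bar>)" for z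
  proof (cases "u z = 0")
    case False
    \<comment> \<open>Here \<open>0 \<le> \<epsilon> \<le> 1\<close> enters: \<open>|y|\<^sup>2 + \<epsilon> |x|\<^sup>2\<close> is at most \<open>|z|\<^sup>2\<close>.\<close>
    define A where "A = (norm (fst z))\<^sup>2 + \<epsilon> * (norm (snd z))\<^sup>2"
    have "0 \<le> A" using \<epsilon> by (simp add: A_def)
    moreover have "A \<le> (norm z)\<^sup>2"
      unfolding A_def norm_prod_sq using \<epsilon> by (simp add: mult_left_le_one_le)
    ultimately have frac: "\<bar>A / (norm z)\<^sup>2\<bar> \<le> 1"
      by (simp add: divide_le_eq_1)
    have "\<bar>q * (A / (norm z)\<^sup>2)\<bar> \<le> \<bar>q\<bar> * 1"
      unfolding abs_mult by (intro mult_left_mono frac) simp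
    then have "\<bar>\<kappa> + p + q * A / (norm z)\<^sup>2\<bar> \<le> \<bar>\<kappa> + p\<bar> + \<bar>q\<bar>"
      unfolding times_divide_eq_right mult_1_right by linarith
    then have 1: "\<bar>(\<kappa> + p + q * A / (norm z)\<^sup>2) * (u z)\<^sup>2\<bar>
        \<le> (\<bar>\<kappa> + p\<bar> + \<bar>q\<bar>) * B\<^sup>2"
      unfolding abs_mult by (intro mult_mono) (use u2 in auto)
    have "norm (fst z, \<epsilon> *\<^sub>R snd z) \<le> norm z"
      by (rule power2_le_imp_le) (use \<epsilon> in \<open>simp_all add: norm_prod_sq power_mult_distrib
          mult_left_le_one_le power_le_one\<close>)
    then have "norm (fst z, \<epsilon> *\<^sub>R snd z) \<le> \<bar>r\<bar>" using r[OF False] by linarith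
    then have "\<bar>grad u z \<bullet> (fst z, \<epsilon> *\<^sub>R snd z)\<bar> \<le> B * \<bar>r\<bar>"
      by (intro order_trans[OF Cauchy_Schwarz_ineq2] mult_mono B) auto
    then have 2: "\<bar>2 * u z * (grad u z \<bullet> (fst z, \<epsilon> *\<^sub>R snd z))\<bar> \<le> 2 * B * (B * \<bar>r\<bar>)"
      unfolding abs_mult by (intro mult_mono) (use B in auto)
    from 1 2 show ?thesis unfolding dilation_density_def \<kappa>_def[symmetric] A_def[symmetric] by linarith
  next
    case True
    then show ?thesis using B(4) by (simp add: dilation_density_def)
  qed
  show g: "integrable lborel (\<lambda>z. weight p q z * dilation_density p q \<epsilon> u z)"
  proof (rule integrable_weight_mult[OF p pq _ dens])
    fix z assume "dilation_density p q \<epsilon> u z \<noteq> 0"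
    then have "u z \<noteq> 0" by (auto simp: dilation_density_def)
    then show "norm z \<le> r" by (rule r)
  qed measurable
  have [measurable]: "f \<in> borel_measurable borel" "g \<in> borel_measurable borel"
    unfolding f_def[abs_def] g_def[abs_def] by measurable
  let ?G = "\<lambda>t z. exp (\<kappa> * t) * g (dilation \<epsilon> t z) * indicator {0..1::real} t"
  have [measurable]: "(\<lambda>x. dilation \<epsilon> (fst x) (snd x) :: 'a \<times> 'b) \<in> borel_measurable (lborel \<Otimes>\<^sub>M lborel)"
  proof -
    have "(\<lambda>x. dilation \<epsilon> (fst x) (snd x) :: 'a \<times> 'b) \<in> borel_measurable borel"
      unfolding dilation_def by (intro borel_measurable_continuous_onI continuous_intros)
    then show ?thesis by (simp add: lborel_prod)
  qed
  have meas: "case_prod ?G \<in> borel_measurable (lborel \<Otimes>\<^sub>M lborel)"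
    unfolding case_prod_beta' by measurable
  have gi: "integrable lborel g" using g by (simp add: g_def[abs_def])
  have inner: "(\<integral>z. exp (\<kappa> * t) * \<phi> (dilation \<epsilon> t z) * indicator {0..1::real} t \<partial>lborel)
      = indicator {0..1} t * (\<integral>z. \<phi> z \<partial>lborel)"
    if [measurable]: "\<phi> \<in> borel_measurable borel" for \<phi> :: "'a \<times> 'b \<Rightarrow> real" and t
    using integral_dilation[OF that, of \<epsilon> t] by (simp add: \<kappa>_def)
  have pairint: "integrable (lborel \<Otimes>\<^sub>M lborel) (case_prod ?G)"
  proof (rule lborel_pair.Fubini_integrable[OF meas])
    have "(\<lambda>t. \<integral>z. norm (case_prod ?G (t, z)) \<partial>lborel)
        = (\<lambda>t. indicator {0..1} t * (\<integral>z. \<bar>g z\<bar> \<partial>lborel))"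
    proof
      fix t
      show "(\<integral>z. norm (case_prod ?G (t, z)) \<partial>lborel)
          = indicator {0..1} t * (\<integral>z. \<bar>g z\<bar> \<partial>lborel)"
        using inner[of "\<lambda>z. \<bar>g z\<bar>" t] by (simp add: abs_mult)
    qed
    then show "integrable lborel (\<lambda>t. \<integral>z. norm (case_prod ?G (t, z)) \<partial>lborel)"
      by simp
    show "AE t in lborel. integrable lborel (\<lambda>z. case_prod ?G (t, z))"
      using integrable_dilation[OF gi] by simp
  qed
  have FTC: "(\<integral>t. ?G t z \<partial>lborel) = exp \<kappa> * f (dilation \<epsilon> 1 z) - f z" for z
  proof (cases "fst z = 0")
    case False
    have "(\<integral>t. exp (\<kappa> * t) * g (dilation \<epsilon> t z) * indicator {0..1::real} t \<partial>lborel)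
        = exp (\<kappa> * 1) * f (dilation \<epsilon> 1 z) - exp (\<kappa> * 0) * f (dilation \<epsilon> 0 z)"
    proof (rule integral_FTC_Icc_real)
      fix t :: real
      show "((\<lambda>t. exp (\<kappa> * t) * f (dilation \<epsilon> t z)) has_real_derivative exp (\<kappa> * t) * g (dilation \<epsilon> t z)) (at t)"
        unfolding f_def g_def \<kappa>_def by (rule dilation_weighted_square_has_derivative[OF u False])
      have "continuous_on UNIV (\<lambda>t. g (dilation \<epsilon> t z))"
        unfolding g_def
        by (rule continuous_on_compose2[OF continuous_dilation_density[OF u]])
           (use False in \<open>auto simp: dilation_def intro!: continuous_intros\<close>)
      then show "isCont (\<lambda>t. exp (\<kappa> * t) * g (dilation \<epsilon> t z)) t"
        by (intro continuous_intros) (simp add: continuous_on_eq_continuous_at)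
    qed simp
    then show ?thesis by (simp add: dilation_def)
  qed (simp add: f_def g_def)
  have "(\<integral>z. g z \<partial>lborel) = (\<integral>t. indicator {0..1::real} t * (\<integral>z. g z \<partial>lborel) \<partial>lborel)"
    by simp
  also have "\<dots> = (\<integral>t. (\<integral>z. ?G t z \<partial>lborel) \<partial>lborel)"
    by (intro Bochner_Integration.integral_cong refl inner[symmetric]) measurable
  also have "\<dots> = (\<integral>z. (\<integral>t. ?G t z \<partial>lborel) \<partial>lborel)"
    by (rule lborel_pair.Fubini_integral[OF pairint, symmetric])
  also have "\<dots> = (\<integral>z. exp \<kappa> * f (dilation \<epsilon> 1 z) - f z \<partial>lborel)"
    by (simp add: FTC)
  also have "\<dots> = exp \<kappa> * (\<integral>z. f (dilation \<epsilon> 1 z) \<partial>lborel) - (\<integral>z. f z \<partial>lborel)"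
    using f integrable_dilation[OF f, of \<epsilon> 1] by simp
  also have "\<dots> = 0"
    using integral_dilation[of f \<epsilon> 1] by (simp add: \<kappa>_def)
  finally show "(\<integral>z. weight p q z * dilation_density p q \<epsilon> u z \<partial>lborel) = 0"
    by (simp add: g_def)
qed

section \<open>The ground state identity\<close>

text \<open>
  The logarithmic gradient of \<open>|y|\<^sup>\<sigma> |z|\<^sup>\<tau>\<close>.
\<close>

definition hardy_field :: "real \<Rightarrow> real \<Rightarrow> 'a::euclidean_space \<times> 'b::euclidean_space \<Rightarrow> 'a \<times> 'b" where
  "hardy_field \<sigma> \<tau> z = (\<sigma> / (norm (fst z))\<^sup>2) *\<^sub>R (fst z, 0) + (\<tau> / (norm z)\<^sup>2) *\<^sub>R z"

lemma weight_div_sq: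
  assumes "fst z \<noteq> 0"
  shows "weight p q z / (norm (fst z))\<^sup>2 = weight (p - 2) q z" "weight p q z / (norm z)\<^sup>2 = weight p (q - 2) z"
proof -
  have "z \<noteq> 0" using assms by auto
  then show "weight p q z / (norm (fst z))\<^sup>2 = weight (p - 2) q z" "weight p q z / (norm z)\<^sup>2 = weight p (q - 2) z"
    using assms by (simp_all add: weight_def powr_diff powr_numeral)
qed

lemma norm_sum_scaleR_sq:
  fixes v w :: "'a::real_inner"
  shows "(norm (x *\<^sub>R v + y *\<^sub>R w))\<^sup>2 = x\<^sup>2 * (v \<bullet> v) + 2 * x * y * (v \<bullet> w) + y\<^sup>2 * (w \<bullet> w)"
  unfolding power2_norm_eq_inner
  by (simp add: inner_add_left inner_add_right inner_commute power2_eq_square algebra_simps)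

lemma norm_hardy_field_sq:
  assumes "fst z \<noteq> 0"
  shows "(norm (hardy_field \<sigma> \<tau> z))\<^sup>2
    = \<sigma>\<^sup>2 / (norm (fst z))\<^sup>2 + (2 * \<sigma> * \<tau> + \<tau>\<^sup>2) / (norm z)\<^sup>2"
proof -
  define Y where "Y = (norm (fst z))\<^sup>2"
  define Z where "Z = (norm z)\<^sup>2"
  have yy: "(fst z, 0) \<bullet> (fst z, 0) = Y" "(fst z, 0) \<bullet> z = Y" "z \<bullet> z = Z"
    by (simp_all add: Y_def Z_def inner_prod_def power2_norm_eq_inner)
  have "Y \<noteq> 0" "Z \<noteq> 0" using assms by (auto simp: Y_def Z_def)
  then show ?thesis
    unfolding hardy_field_def Y_def[symmetric] Z_def[symmetric] norm_sum_scaleR_sq yy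
    by (simp add: field_simps power2_eq_square)
qed

text \<open>
  Expanding the square produces the cross term \<open>u \<nabla>u \<cdot> V\<close>; up to multiples of \<open>u\<^sup>2\<close> it consists of the two
  divergences in the second and third line, which have integral zero.
\<close>

lemma hardy_pointwise:
  fixes u :: "'a::euclidean_space \<times> 'b::euclidean_space \<Rightarrow> real"
  defines "k \<equiv> real DIM('a)" and "m \<equiv> real DIM('b)"
  shows "weight a (- b) z * (norm (grad u z - u z *\<^sub>R hardy_field \<sigma> \<tau> z))\<^sup>2
    = weight a (- b) z * (norm (grad u z))\<^sup>2
      - \<sigma> * (weight (a - 2) (- b) z * dilation_density (a - 2) (- b) 0 u z)
      - \<tau> * (weight a (- b - 2) z * dilation_density a (- b - 2) 1 u z)
      + \<sigma> * (\<sigma> + k + a - 2) * (weight (a - 2) (- b) z * (u z)\<^sup>2)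
      + (\<tau> * (\<tau> + 2 * \<sigma> + k + m + a - 2 - b) - \<sigma> * b) * (weight a (- b - 2) z * (u z)\<^sup>2)"
proof (cases "fst z = 0")
  case False
  define Y where "Y = (norm (fst z))\<^sup>2"
  define Z where "Z = (norm z)\<^sup>2"
  define w where "w = weight a (- b) z"
  define gy where "gy = grad u z \<bullet> (fst z, 0)"
  define gz where "gz = grad u z \<bullet> z"
  have nz: "Y \<noteq> 0" "Z \<noteq> 0" using False by (auto simp: Y_def Z_def)
  have w: "weight (a - 2) (- b) z = w / Y" "weight a (- b - 2) z = w / Z"
    using weight_div_sq[OF False, of a "-b"] by (simp_all add: w_def Y_def Z_def)
  have d0: "dilation_density (a - 2) (- b) 0 u z = (k + (a - 2) - b * Y / Z) * (u z)\<^sup>2 + 2 * u z * gy"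
    by (simp add: dilation_density_def k_def Y_def Z_def gy_def)
  have d1: "dilation_density a (- b - 2) 1 u z = (k + m + a - b - 2) * (u z)\<^sup>2 + 2 * u z * gz"
  proof -
    have "(- b - 2) * ((norm (fst z))\<^sup>2 + 1 * (norm (snd z))\<^sup>2) / (norm z)\<^sup>2 = - b - 2"
      using nz by (simp add: norm_prod_sq[symmetric] Z_def)
    then show ?thesis by (simp add: dilation_density_def k_def m_def gz_def)
  qed
  have V: "grad u z \<bullet> hardy_field \<sigma> \<tau> z = \<sigma> / Y * gy + \<tau> / Z * gz"
    by (simp add: hardy_field_def Y_def Z_def gy_def gz_def inner_add_right
        del: scaleR_Pair)
  have N: "(norm (grad u z - u z *\<^sub>R hardy_field \<sigma> \<tau> z))\<^sup>2
      = (norm (grad u z))\<^sup>2 - 2 * u z * (\<sigma> / Y * gy + \<tau> / Z * gz)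
        + (u z)\<^sup>2 * (\<sigma>\<^sup>2 / Y + (2 * \<sigma> * \<tau> + \<tau>\<^sup>2) / Z)"
    using norm_sum_scaleR_sq[of 1 "grad u z" "- u z" "hardy_field \<sigma> \<tau> z"]
    unfolding power2_norm_eq_inner[symmetric] norm_hardy_field_sq[OF False] V Y_def[symmetric] Z_def[symmetric]
    by simp
  show ?thesis
    unfolding w w_def[symmetric] d0 d1 N
    using nz by (simp add: field_simps power2_eq_square)
qed simp

lemma hardy_identity:
  fixes u :: "'a::euclidean_space \<times> 'b::euclidean_space \<Rightarrow> real"
  defines "k \<equiv> real DIM('a)" and "m \<equiv> real DIM('b)"
  assumes u: "u \<in> Cc_infinity" and a: "k + a > 2" and b: "k + m + a - 2 - b > 0"
  shows "integrable lborel (\<lambda>z. weight (a - 2) (- b) z * (u z)\<^sup>2)"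
    and "integrable lborel (\<lambda>z. weight a (- b - 2) z * (u z)\<^sup>2)"
    and "integrable lborel (\<lambda>z. weight a (- b) z * (norm (grad u z - u z *\<^sub>R hardy_field \<sigma> \<tau> z))\<^sup>2)"
    and "(\<integral>z. weight a (- b) z * (norm (grad u z))\<^sup>2 \<partial>lborel)
      = - \<sigma> * (\<sigma> + k + a - 2) * (\<integral>z. weight (a - 2) (- b) z * (u z)\<^sup>2 \<partial>lborel)
        + (\<sigma> * b - \<tau> * (\<tau> + 2 * \<sigma> + k + m + a - 2 - b)) * (\<integral>z. weight a (- b - 2) z * (u z)\<^sup>2 \<partial>lborel)
        + (\<integral>z. weight a (- b) z * (norm (grad u z - u z *\<^sub>R hardy_field \<sigma> \<tau> z))\<^sup>2 \<partial>lborel)"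
proof -
  obtain B r where B: "\<And>z. \<bar>u z\<bar> \<le> B" "\<And>z. norm (grad u z) \<le> B"
    "\<And>z. r < norm z \<Longrightarrow> u z = 0" "\<And>z. r < norm z \<Longrightarrow> grad u z = 0" "0 \<le> B"
    using Cc_infinity_bounds[OF u] by metis
  have r: "u z \<noteq> 0 \<Longrightarrow> norm z \<le> r" "grad u z \<noteq> 0 \<Longrightarrow> norm z \<le> r" for z
    using B(3,4)[of z] by linarith+
  have [measurable]: "u \<in> borel_measurable borel" "grad u \<in> borel_measurable borel"
    using Cc_infinityD(2,3)[OF u] by (auto intro: borel_measurable_continuous_onI)
  have u2: "\<bar>(u z)\<^sup>2\<bar> \<le> B\<^sup>2" "\<bar>(norm (grad u z))\<^sup>2\<bar> \<le> B\<^sup>2" for z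
    using B(1,2)[of z] B(5) by (auto simp: abs_le_square_iff[symmetric])
  show i0: "integrable lborel (\<lambda>z. weight (a - 2) (- b) z * (u z)\<^sup>2)"
    by (rule integrable_weight_mult[OF _ _ _ u2(1), where r = r]) (use a b r in \<open>auto simp: k_def m_def\<close>)
  show i1: "integrable lborel (\<lambda>z. weight a (- b - 2) z * (u z)\<^sup>2)"
    by (rule integrable_weight_mult[OF _ _ _ u2(1), where r = r]) (use a b r in \<open>auto simp: k_def m_def\<close>)
  have i2: "integrable lborel (\<lambda>z. weight a (- b) z * (norm (grad u z))\<^sup>2)"
    by (rule integrable_weight_mult[OF _ _ _ u2(2), where r = r]) (use a b r in \<open>auto simp: k_def m_def\<close>)
  have f0: "integrable lborel (\<lambda>z. weight (a - 2) (- b) z * dilation_density (a - 2) (- b) 0 u z)"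
      "(\<integral>z. weight (a - 2) (- b) z * dilation_density (a - 2) (- b) 0 u z \<partial>lborel) = 0"
    by (rule weighted_dilation_identity[OF u]; use a b in \<open>simp add: k_def m_def\<close>)+
  have f1: "integrable lborel (\<lambda>z. weight a (- b - 2) z * dilation_density a (- b - 2) 1 u z)"
      "(\<integral>z. weight a (- b - 2) z * dilation_density a (- b - 2) 1 u z \<partial>lborel) = 0"
    by (rule weighted_dilation_identity[OF u]; use a b in \<open>simp add: k_def m_def\<close>)+
  note pw = hardy_pointwise[of a b _ u \<sigma> \<tau>, folded k_def m_def]
  show "integrable lborel (\<lambda>z. weight a (- b) z * (norm (grad u z - u z *\<^sub>R hardy_field \<sigma> \<tau> z))\<^sup>2)"
    unfolding pw
    by (intro Bochner_Integration.integrable_add Bochner_Integration.integrable_diff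
        integrable_mult_right i0 i1 i2 f0 f1)
  have "(\<integral>z. weight a (- b) z * (norm (grad u z - u z *\<^sub>R hardy_field \<sigma> \<tau> z))\<^sup>2 \<partial>lborel)
    = (\<integral>z. weight a (- b) z * (norm (grad u z))\<^sup>2 \<partial>lborel)
      - \<sigma> * (\<integral>z. weight (a - 2) (- b) z * dilation_density (a - 2) (- b) 0 u z \<partial>lborel)
      - \<tau> * (\<integral>z. weight a (- b - 2) z * dilation_density a (- b - 2) 1 u z \<partial>lborel)
      + \<sigma> * (\<sigma> + k + a - 2) * (\<integral>z. weight (a - 2) (- b) z * (u z)\<^sup>2 \<partial>lborel)
      + (\<tau> * (\<tau> + 2 * \<sigma> + k + m + a - 2 - b) - \<sigma> * b) * (\<integral>z. weight a (- b - 2) z * (u z)\<^sup>2 \<partial>lborel)"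
    unfolding pw
    using i0 i1 i2 f0(1) f1(1) by simp
  then show "(\<integral>z. weight a (- b) z * (norm (grad u z))\<^sup>2 \<partial>lborel)
      = - \<sigma> * (\<sigma> + k + a - 2) * (\<integral>z. weight (a - 2) (- b) z * (u z)\<^sup>2 \<partial>lborel)
        + (\<sigma> * b - \<tau> * (\<tau> + 2 * \<sigma> + k + m + a - 2 - b)) * (\<integral>z. weight a (- b - 2) z * (u z)\<^sup>2 \<partial>lborel)
        + (\<integral>z. weight a (- b) z * (norm (grad u z - u z *\<^sub>R hardy_field \<sigma> \<tau> z))\<^sup>2 \<partial>lborel)"
    unfolding f0(2) f1(2) by (simp add: algebra_simps)
qed

text \<open>
  A vanishing integral forces \<open>u = 0\<close> almost everywhere off \<open>{y = 0}\<close>, and \<open>{y = 0}\<close> is contained in a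
  hyperplane. An open set such as \<open>{u \<noteq> 0}\<close> is not negligible unless it is empty.
\<close>

lemma weighted_square_integral_pos:
  fixes u :: "'a::euclidean_space \<times> 'b::euclidean_space \<Rightarrow> real"
  assumes u: "continuous_on UNIV u" "u \<noteq> (\<lambda>_. 0)"
    and int: "integrable lborel (\<lambda>z. weight p q z * (u z)\<^sup>2)"
  shows "0 < (\<integral>z. weight p q z * (u z)\<^sup>2 \<partial>lborel)"
proof (rule ccontr)
  assume "\<not> ?thesis"
  moreover have "0 \<le> (\<integral>z. weight p q z * (u z)\<^sup>2 \<partial>lborel)" by (intro integral_nonneg_AE) simp
  ultimately have "(\<integral>z. weight p q z * (u z)\<^sup>2 \<partial>lborel) = 0" by linarith
  then have ae: "AE z in lborel. weight p q z * (u z)\<^sup>2 = 0"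
    by (subst (asm) integral_nonneg_eq_0_iff_AE[OF int]) auto
  define S where "S = {z. fst z \<noteq> 0 \<and> u z \<noteq> 0}"
  have "open {z::'a \<times> 'b. fst z \<noteq> 0}" "open {z. u z \<noteq> 0}"
    by (intro open_Collect_neq continuous_intros u)+
  then have S: "open S" unfolding S_def by (rule open_Collect_conj)
  have "AE z in lborel. z \<notin> S"
    using ae
  proof eventually_elim
    fix z assume "weight p q z * (u z)\<^sup>2 = 0"
    then show "z \<notin> S" using weight_pos[of z p q]
      by (cases "fst z = 0") (auto simp: S_def)
  qed
  then have "S \<in> null_sets lborel"
    using S by (subst (asm) AE_iff_null) auto
  then have "negligible S"
    unfolding negligible_iff_null_sets by (rule null_sets_completionI)
  then have "S = {}" using open_not_negligible[OF S] by blast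
  then have "open {z. u z \<noteq> 0}" "{z. u z \<noteq> 0} \<subseteq> {z. fst z = 0}"
    using \<open>open {z. u z \<noteq> 0}\<close> by (auto simp: S_def)
  moreover have "negligible {z :: 'a \<times> 'b. fst z = 0}"
  proof -
    obtain i :: 'a where i: "i \<in> Basis" using nonempty_Basis by blast
    have "negligible {z :: 'a \<times> 'b. (i, 0) \<bullet> z = 0}"
      using i by (intro negligible_hyperplane) (auto simp: zero_prod_def nonzero_Basis)
    then show ?thesis by (rule negligible_subset) (auto simp: inner_prod_def)
  qed
  ultimately have "{z. u z \<noteq> 0} = {}"
    using open_not_negligible[of "{z. u z \<noteq> 0}"] negligible_subset by blast
  then show False using u(2) by auto
qed

section \<open>Near-extremal test functions\<close>

lemma bump_bounds: "0 \<le> bump t" "bump t \<le> 1"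
proof -
  have f: "0 \<le> flat_exp 0 t" "flat_exp 0 t \<le> 1" for t by (simp_all add: flat_exp_def)
  show "0 \<le> bump t" unfolding bump_def by (intro mult_nonneg_nonneg f)
  show "bump t \<le> 1" unfolding bump_def by (intro mult_le_one f)
qed

lemma bump_lower: "\<bar>t\<bar> \<le> 1 / 2 \<Longrightarrow> exp (- 4) \<le> bump t"
proof -
  assume t: "\<bar>t\<bar> \<le> 1 / 2"
  have f: "exp (- 2) \<le> flat_exp 0 r" if "1 / 2 \<le> r" for r
    using that by (simp add: flat_exp_def field_simps)
  have "exp (- 2) * exp (- 2) \<le> bump t"
    unfolding bump_def by (intro mult_mono f) (use t in \<open>auto simp: flat_exp_def\<close>)
  then show ?thesis by (simp add: exp_add[symmetric])
qed

lemma deriv_bump_bound: obtains K where "1 \<le> K" "\<And>t. \<bar>deriv bump t\<bar> \<le> K"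
proof -
  have "bounded (deriv bump ` {-1..1})"
    by (intro compact_imp_bounded compact_continuous_image
        continuous_on_subset[OF Cn_continuous[OF deriv_Cn_real(2)[OF Cn_bump, of 0]]]) auto
  then obtain K where K: "\<forall>t\<in>{-1..1}. \<bar>deriv bump t\<bar> \<le> K"
    by (auto simp: bounded_iff)
  have "\<bar>deriv bump t\<bar> \<le> max 1 K" for t
  proof (cases "t \<in> {-1..1}")
    case True
    then show ?thesis using K by (simp add: le_max_iff_disj)
  next
    case False
    then have "deriv bump t = 0"
      by (intro deriv_eq_0_outside[of 0, OF Cn_bump bump_eq_0]) auto
    then show ?thesis by simp
  qed
  then show thesis by (intro that[of "max 1 K"]) auto
qed

text \<open>
  The function \<open>|y|\<^sup>\<sigma> |z|\<^sup>\<tau> \<chi>(ln |y| / n) \<chi>(ln |z| / n)\<close> with the bump \<open>\<chi>\<close> (see \<open>trial_eq\<close>). It is written in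
  terms of \<open>|y|\<^sup>2\<close> and \<open>|z|\<^sup>2\<close>, whence the halved exponents and the scale \<open>2 n\<close>, because these are smooth
  everywhere; the cutoff functions vanish near \<open>0\<close>.
\<close>

definition trial :: "real \<Rightarrow> real \<Rightarrow> real \<Rightarrow> 'a::euclidean_space \<times> 'b::euclidean_space \<Rightarrow> real" where
  "trial \<sigma> \<tau> n z = power_cutoff bump (2 * n) (\<sigma> / 2) (fst z \<bullet> fst z)
     * power_cutoff bump (2 * n) (\<tau> / 2) (z \<bullet> z)"

lemma power_cutoff_inner_self:
  assumes "v \<noteq> 0"
  shows "power_cutoff h (2 * n) (p / 2) (v \<bullet> v) = norm v powr p * h (ln (norm v) / n)"
proof -
  have "ln (v \<bullet> v) = 2 * ln (norm v)"
    using assms by (simp add: power2_norm_eq_inner[symmetric] ln_realpow)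
  then show ?thesis using assms by (simp add: power_cutoff_def powr_def)
qed

lemma trial_eq:
  assumes "fst z \<noteq> 0"
  shows "trial \<sigma> \<tau> n z = weight \<sigma> \<tau> z * (bump (ln (norm (fst z)) / n) * bump (ln (norm z) / n))"
proof -
  have "z \<noteq> 0" using assms by auto
  then show ?thesis using assms by (simp add: trial_def power_cutoff_inner_self weight_def)
qed

lemma trial_Cc_infinity:
  assumes "n > 0"
  shows "(trial \<sigma> \<tau> n :: 'a::euclidean_space \<times> 'b::euclidean_space \<Rightarrow> real) \<in> Cc_infinity"
proof -
  have "Cn j (trial \<sigma> \<tau> n :: 'a \<times> 'b \<Rightarrow> real)" for j
    unfolding trial_def[abs_def]
    by (intro Cn_mult Cn_compose[OF Cn_power_cutoff[OF _ Cn_bump bump_eq_0]]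
        Cn_inner_self[OF bounded_linear_fst] Cn_inner_self[OF bounded_linear_ident])
       (use assms in auto)
  moreover have "compact (closure {z :: 'a \<times> 'b. trial \<sigma> \<tau> n z \<noteq> 0})"
  proof -
    have "norm z \<le> exp n" if "trial \<sigma> \<tau> n z \<noteq> 0" for z :: "'a \<times> 'b"
    proof -
      have "fst z \<noteq> 0" using that by (auto simp: trial_def power_cutoff_def)
      then have "bump (ln (norm z) / n) \<noteq> 0" "z \<noteq> 0" using that by (auto simp: trial_eq)
      then have "\<bar>ln (norm z) / n\<bar> < 1" using bump_eq_0[of "ln (norm z) / n"] by linarith
      then have "ln (norm z) \<le> n" using assms by (simp add: abs_less_iff field_simps)
      then show ?thesis using \<open>z \<noteq> 0\<close> by (rule norm_le_exp[rotated])
    qed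
    then have "bounded {z :: 'a \<times> 'b. trial \<sigma> \<tau> n z \<noteq> 0}" unfolding bounded_iff by auto
    then show ?thesis by (simp add: compact_closure)
  qed
  ultimately show ?thesis by (simp add: Cc_infinity_def)
qed

lemma GDERIV_comp_inner_self:
  fixes f :: "'a::euclidean_space \<Rightarrow> 'b::euclidean_space"
  assumes f: "bounded_linear f" and F: "(F has_real_derivative F') (at (f z \<bullet> f z))"
    and adj: "\<And>h. f h \<bullet> f z = h \<bullet> D"
  shows "GDERIV (\<lambda>z. F (f z \<bullet> f z)) z :> (2 * F') *\<^sub>R D"
proof -
  have d: "((\<lambda>z. f z \<bullet> f z) has_derivative (\<lambda>h. f z \<bullet> f h + f h \<bullet> f z)) (at z)"
    by (intro has_derivative_inner bounded_linear_imp_has_derivative f)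
  have "((\<lambda>z. F (f z \<bullet> f z)) has_derivative (\<lambda>h. F' * (f z \<bullet> f h + f h \<bullet> f z))) (at z)"
    by (rule has_derivative_compose[OF d F[unfolded has_field_derivative_def]])
  moreover have "F' * (f z \<bullet> f h + f h \<bullet> f z) = h \<bullet> ((2 * F') *\<^sub>R D)" for h
    by (simp add: inner_commute[of "f z" "f h"] adj)
  ultimately show ?thesis unfolding gderiv_def by simp
qed

text \<open>
  Subtracting \<open>u V\<close> removes the derivative of the power \<open>|y|\<^sup>\<sigma> |z|\<^sup>\<tau>\<close>. What survives are derivatives of the
  cutoffs, which carry a factor \<open>1/n\<close>.
\<close>

lemma grad_trial:
  fixes z :: "'a::euclidean_space \<times> 'b::euclidean_space"
  assumes n: "n > 0" and z: "fst z \<noteq> 0"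
  defines "ly \<equiv> ln (norm (fst z)) / n" and "lz \<equiv> ln (norm z) / n"
  shows "grad (trial \<sigma> \<tau> n) z - trial \<sigma> \<tau> n z *\<^sub>R hardy_field \<sigma> \<tau> z
    = weight \<sigma> \<tau> z *\<^sub>R hardy_field (deriv bump ly * bump lz / n) (bump ly * deriv bump lz / n) z"
proof -
  have z0: "z \<noteq> 0" using z by auto
  let ?F = "power_cutoff bump (2 * n) (\<sigma> / 2)" and ?G = "power_cutoff bump (2 * n) (\<tau> / 2)"
  have d: "(power_cutoff bump (2 * n) p has_real_derivative
      power_cutoff (\<lambda>s. p * bump s + deriv bump s / (2 * n)) (2 * n) (p - 1) t) (at t)" for p t
    by (rule power_cutoff_has_real_derivative[OF _ bump_eq_0
        deriv_eq_0_outside[of 0, OF Cn_bump bump_eq_0] deriv_Cn_real(1)[of 0, OF Cn_bump]])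
       (use n in auto)
  have dp: "2 * power_cutoff (\<lambda>s. p / 2 * bump s + deriv bump s / (2 * n)) (2 * n) (p / 2 - 1) (v \<bullet> v)
      = norm v powr p * ((p * bump (ln (norm v) / n) + deriv bump (ln (norm v) / n) / n) / (norm v)\<^sup>2)"
    if "v \<noteq> 0" for v :: "'c::euclidean_space" and p
  proof -
    have e: "p / 2 - 1 = (p - 2) / 2" by simp
    show ?thesis
      unfolding e power_cutoff_inner_self[OF that]
      using that n by (simp add: powr_diff powr_numeral field_simps)
  qed
  have gF: "GDERIV (\<lambda>z. ?F (fst z \<bullet> fst z)) z :>
      (norm (fst z) powr \<sigma> * ((\<sigma> * bump ly + deriv bump ly / n) / (norm (fst z))\<^sup>2)) *\<^sub>R (fst z, 0)"
    unfolding ly_def dp[OF z, symmetric]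
    by (rule GDERIV_comp_inner_self[OF bounded_linear_fst d]) (simp add: inner_prod_def)
  have gG: "GDERIV (\<lambda>z. ?G (z \<bullet> z)) z :>
      (norm z powr \<tau> * ((\<tau> * bump lz + deriv bump lz / n) / (norm z)\<^sup>2)) *\<^sub>R z"
    unfolding lz_def dp[OF z0, symmetric]
    by (rule GDERIV_comp_inner_self[OF bounded_linear_ident d]) simp
  have F: "?F (fst z \<bullet> fst z) = norm (fst z) powr \<sigma> * bump ly"
    and G: "?G (z \<bullet> z) = norm z powr \<tau> * bump lz"
    using power_cutoff_inner_self[OF z] power_cutoff_inner_self[OF z0] by (simp_all add: ly_def lz_def)
  define v where "v = (fst z, 0::'b)"
  have g: "grad (trial \<sigma> \<tau> n) z =
      (norm (fst z) powr \<sigma> * bump ly) *\<^sub>R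
        ((norm z powr \<tau> * ((\<tau> * bump lz + deriv bump lz / n) / (norm z)\<^sup>2)) *\<^sub>R z)
      + (norm z powr \<tau> * bump lz) *\<^sub>R
        ((norm (fst z) powr \<sigma> * ((\<sigma> * bump ly + deriv bump ly / n) / (norm (fst z))\<^sup>2)) *\<^sub>R v)"
    unfolding trial_def[abs_def] v_def
    by (rule grad_eq[OF GDERIV_mult[OF gF gG, unfolded F G]])
  show ?thesis
    unfolding g trial_eq[OF z] hardy_field_def v_def[symmetric] ly_def[symmetric] lz_def[symmetric] weight_def
    by (simp add: algebra_simps add_divide_distrib del: scaleR_Pair)
qed

lemma hardy_field_bound:
  assumes z: "fst z \<noteq> 0" and \<alpha>: "\<bar>\<alpha>\<bar> \<le> c" and \<beta>: "\<bar>\<beta>\<bar> \<le> c"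
  shows "(norm (hardy_field \<alpha> \<beta> z))\<^sup>2 \<le> 4 * c\<^sup>2 / (norm (fst z))\<^sup>2"
proof -
  have y: "0 < norm (fst z)" and yz: "norm (fst z) \<le> norm z"
    using z norm_fst_le[of "fst z" "snd z"] by simp_all
  have c: "0 \<le> c" using \<alpha> by linarith
  have "norm (hardy_field \<alpha> \<beta> z) \<le> \<bar>\<alpha>\<bar> / (norm (fst z))\<^sup>2 * norm (fst z) + \<bar>\<beta>\<bar> / (norm z)\<^sup>2 * norm z"
    unfolding hardy_field_def
    by (rule order_trans[OF norm_triangle_ineq]) (simp add: norm_Pair del: scaleR_Pair)
  also have "\<dots> = \<bar>\<alpha>\<bar> / norm (fst z) + \<bar>\<beta>\<bar> / norm z"
    by (simp add: power2_eq_square)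
  also have "\<dots> \<le> c / norm (fst z) + c / norm (fst z)"
    using y yz \<alpha> \<beta> c by (intro add_mono frac_le) auto
  finally have "norm (hardy_field \<alpha> \<beta> z) \<le> 2 * c / norm (fst z)" by simp
  then have "(norm (hardy_field \<alpha> \<beta> z))\<^sup>2 \<le> (2 * c / norm (fst z))\<^sup>2"
    by (rule power_mono) simp
  then show ?thesis by (simp add: power_divide power_mult_distrib)
qed


lemma cone_shell_pos:
  fixes p q :: real
  defines "S \<equiv> {z :: 'a::euclidean_space \<times> 'b::euclidean_space. exp (- 1) * norm z \<le> norm (fst z)}"
  shows "0 < (\<integral>\<^sup>+z. ennreal (weight p q z) * indicator S z * indicator {0..<1} (ln (norm z)) \<partial>lborel)"
proof (rule ccontr)
  have [measurable]: "S \<in> sets borel"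
    unfolding S_def by (intro borel_closed closed_Collect_le continuous_intros)
  assume "\<not> ?thesis"
  then have ae: "AE z in lborel. ennreal (weight p q z) * indicator S z * indicator {0..<1} (ln (norm z)) = 0"
    by (subst (asm) not_gr_zero, subst (asm) nn_integral_0_iff_AE) auto
  define U where "U = {z :: 'a \<times> 'b. exp (- 1) * norm z < norm (fst z) \<and> 1 < norm z \<and> norm z < exp 1}"
  have U: "open U"
    unfolding U_def by (intro open_Collect_conj open_Collect_less continuous_intros)
  have pos: "ennreal (weight p q z) * indicator S z * indicator {0..<1} (ln (norm z)) \<noteq> 0" if "z \<in> U" for z
  proof -
    have z: "1 < norm z" "norm z < exp 1" "exp (- 1) * norm z < norm (fst z)"
      using that by (auto simp: U_def)
    have "0 < norm (fst z)" using z(3) by (rule le_less_trans[rotated]) simp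
    then have "0 < weight p q z" by (intro weight_pos) auto
    moreover have "0 < ln (norm z)" using z(1) by (rule ln_gt_zero)
    moreover have "z \<noteq> 0" using z(1) by auto
    then have "ln (norm z) < ln (exp 1)"
      using z(2) by (intro ln_less_cancel_iff[THEN iffD2]) auto
    then have "ln (norm z) < 1" by simp
    ultimately show ?thesis using z(3) by (simp add: S_def)
  qed
  from ae have "AE z in lborel. z \<notin> U"
    by eventually_elim (use pos in auto)
  then have "U \<in> null_sets lborel"
    using U by (subst (asm) AE_iff_null) auto
  then have "negligible U"
    unfolding negligible_iff_null_sets by (rule null_sets_completionI)
  then have "U = {}" using open_not_negligible[OF U] by blast
  moreover have "\<exists>z. z \<in> U"
  proof -
    obtain i :: 'a where i: "i \<in> Basis" using nonempty_Basis by blast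
    have "norm (exp (1 / 2) *\<^sub>R i, 0::'b) = exp (1 / 2)"
      using i by (simp add: norm_Pair)
    moreover have "exp (- 1) * exp (1 / 2) < exp (1 / 2 :: real)"
      by simp
    ultimately have "(exp (1 / 2) *\<^sub>R i, 0) \<in> U"
      using i by (simp add: U_def)
    then show ?thesis by blast
  qed
  ultimately show False by blast
qed

text \<open>
  The integrand is at most \<open>4 K\<^sup>2 / n\<^sup>2\<close> times a weight of degree minus the dimension, and it is supported in
  \<open>|ln |z|| \<le> n\<close>, an interval of length \<open>2 n\<close> in the logarithmic variable.
\<close>

lemma trial_remainder_upper:
  fixes a b \<sigma> \<tau> n K :: real
  defines "R \<equiv> \<lambda>z :: 'a::euclidean_space \<times> 'b::euclidean_space. weight a (- b) z *
      (norm (grad (trial \<sigma> \<tau> n) z - trial \<sigma> \<tau> n z *\<^sub>R hardy_field \<sigma> \<tau> z))\<^sup>2"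
  assumes n: "n > 0" and K: "1 \<le> K" "\<And>t. \<bar>deriv bump t\<bar> \<le> K"
    and hom: "a - 2 + 2 * \<sigma> - b + 2 * \<tau> = - real DIM('a) - real DIM('b)"
  shows "(\<integral>\<^sup>+z. ennreal (R z) \<partial>lborel) \<le> ennreal (8 * K\<^sup>2 / n) *
      (\<integral>\<^sup>+(z::'a \<times> 'b). ennreal (weight (a - 2 + 2 * \<sigma>) (- b + 2 * \<tau>) z) * indicator {0..<1} (ln (norm z)) \<partial>lborel)"
    (is "_ \<le> _ * ?A")
proof -
  let ?h = "\<lambda>t. ennreal (4 * (K / n)\<^sup>2) * indicator {- n..n} t"
  have "ennreal (R z) \<le> ?h (ln (norm z)) *
      (ennreal (weight (a - 2 + 2 * \<sigma>) (- b + 2 * \<tau>) z) * indicator UNIV z)" for z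
  proof (cases "fst z = 0 \<or> \<bar>ln (norm z)\<bar> > n")
    case True
    have "R z = 0"
    proof (cases "fst z = 0")
      case False
      have "1 \<le> \<bar>ln (norm z) / n\<bar>" using True False n by (auto simp: abs_mult abs_divide field_simps)
      then have "bump (ln (norm z) / n) = 0" "deriv bump (ln (norm z) / n) = 0"
        using bump_eq_0 deriv_eq_0_outside[of 0, OF Cn_bump bump_eq_0] by auto
      then show ?thesis
        unfolding R_def grad_trial[OF n False] by (simp add: hardy_field_def)
    qed (simp add: R_def)
    then show ?thesis by simp
  next
    case False
    then have z: "fst z \<noteq> 0" and l: "ln (norm z) \<in> {- n..n}" by auto
    let ?ly = "ln (norm (fst z)) / n" and ?lz = "ln (norm z) / n"
    have c: "\<bar>deriv bump t * bump r / n\<bar> \<le> K / n" "\<bar>bump r * deriv bump t / n\<bar> \<le> K / n" for t r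
    proof -
      have "\<bar>deriv bump t\<bar> * \<bar>bump r\<bar> \<le> K * 1"
        using K bump_bounds[of r] by (intro mult_mono) auto
      then show "\<bar>deriv bump t * bump r / n\<bar> \<le> K / n" "\<bar>bump r * deriv bump t / n\<bar> \<le> K / n"
        using n by (simp_all add: abs_mult divide_right_mono mult.commute)
    qed
    have "R z = weight (a + 2 * \<sigma>) (- b + 2 * \<tau>) z *
        (norm (hardy_field (deriv bump ?ly * bump ?lz / n) (bump ?ly * deriv bump ?lz / n) z))\<^sup>2"
      unfolding R_def grad_trial[OF n z]
      by (simp add: power_mult_distrib weight_square mult.assoc[symmetric] weight_mult)
    also have "\<dots> \<le> weight (a + 2 * \<sigma>) (- b + 2 * \<tau>) z * (4 * (K / n)\<^sup>2 / (norm (fst z))\<^sup>2)"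
      by (intro mult_left_mono hardy_field_bound z c weight_nonneg)
    also have "\<dots> = 4 * (K / n)\<^sup>2 * (weight (a + 2 * \<sigma>) (- b + 2 * \<tau>) z / (norm (fst z))\<^sup>2)"
      by simp
    also have "\<dots> = 4 * (K / n)\<^sup>2 * weight (a - 2 + 2 * \<sigma>) (- b + 2 * \<tau>) z"
      unfolding weight_div_sq(1)[OF z] by (simp add: algebra_simps)
    finally have "ennreal (R z) \<le> ennreal (4 * (K / n)\<^sup>2 * weight (a - 2 + 2 * \<sigma>) (- b + 2 * \<tau>) z)"
      by (rule ennreal_leI)
    then show ?thesis using l by (simp add: ennreal_mult)
  qed
  then have "(\<integral>\<^sup>+z. ennreal (R z) \<partial>lborel) \<le> (\<integral>\<^sup>+z. ?h (ln (norm z)) *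
      (ennreal (weight (a - 2 + 2 * \<sigma>) (- b + 2 * \<tau>) z) * indicator UNIV (z :: 'a \<times> 'b)) \<partial>lborel)"
    by (rule nn_integral_mono)
  also have "\<dots> = (\<integral>\<^sup>+t. ?h t \<partial>lborel) * (\<integral>\<^sup>+(z::'a \<times> 'b).
      ennreal (weight (a - 2 + 2 * \<sigma>) (- b + 2 * \<tau>) z) * indicator UNIV z * indicator {0..<1} (ln (norm z)) \<partial>lborel)"
    by (rule weight_log_polar) (use hom in auto)
  also have "(\<integral>\<^sup>+t. ?h t \<partial>lborel) = ennreal (8 * K\<^sup>2 / n)"
  proof -
    have "(\<integral>\<^sup>+t. ?h t \<partial>lborel) = ennreal (4 * (K / n)\<^sup>2) * ennreal (2 * n)"
      using n by (simp add: nn_integral_cmult)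
    also have "\<dots> = ennreal (4 * (K / n)\<^sup>2 * (2 * n))"
      using n by (intro ennreal_mult[symmetric]) auto
    also have "4 * (K / n)\<^sup>2 * (2 * n) = 8 * K\<^sup>2 / n"
      using n by (simp add: power2_eq_square field_simps)
    finally show ?thesis .
  qed
  finally show ?thesis by simp
qed

text \<open>
  In the cone \<open>|y| \<ge> |z| / e\<close>, for \<open>|ln |z|| \<le> n / 4\<close>, also \<open>|ln |y|| \<le> n / 4 + 1 \<le> n / 2\<close>. Both cutoffs are thus
  at least \<open>e\<^sup>-\<^sup>4\<close> there, and their squared product is at least \<open>e\<^sup>-\<^sup>1\<^sup>6\<close>.
\<close>

lemma trial_mass_lower:
  fixes a b \<sigma> \<tau> n :: real
  defines "S \<equiv> {z :: 'a::euclidean_space \<times> 'b::euclidean_space. exp (- 1) * norm z \<le> norm (fst z)}"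
  assumes n: "n \<ge> 4"
    and hom: "a - 2 + 2 * \<sigma> - b + 2 * \<tau> = - real DIM('a) - real DIM('b)"
  shows "ennreal (exp (- 16) * n / 2) *
      (\<integral>\<^sup>+z. ennreal (weight (a - 2 + 2 * \<sigma>) (- b + 2 * \<tau>) z) * indicator S z * indicator {0..<1} (ln (norm z)) \<partial>lborel)
    \<le> (\<integral>\<^sup>+(z::'a \<times> 'b). ennreal (weight (a - 2) (- b) z * (trial \<sigma> \<tau> n z)\<^sup>2) \<partial>lborel)"
proof -
  let ?h = "\<lambda>t. ennreal (exp (- 16)) * indicator {- (n / 4)..n / 4} t"
  have [measurable]: "S \<in> sets borel"
    unfolding S_def by (intro borel_closed closed_Collect_le continuous_intros)
  have h: "(\<integral>\<^sup>+t. ?h t \<partial>lborel) = ennreal (exp (- 16) * n / 2)"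
    using n by (simp add: nn_integral_cmult ennreal_mult[symmetric])
  have "(\<integral>\<^sup>+t. ?h t \<partial>lborel) *
      (\<integral>\<^sup>+z. ennreal (weight (a - 2 + 2 * \<sigma>) (- b + 2 * \<tau>) z) * indicator S z * indicator {0..<1} (ln (norm z)) \<partial>lborel)
    = (\<integral>\<^sup>+z. ?h (ln (norm z)) * (ennreal (weight (a - 2 + 2 * \<sigma>) (- b + 2 * \<tau>) z) * indicator S z) \<partial>lborel)"
  proof (rule weight_log_polar[symmetric])
    show "exp t *\<^sub>R z \<in> S \<longleftrightarrow> z \<in> S" for t z
      by (simp add: S_def mult.left_commute[of "exp (- 1)"])
  qed (use hom in auto)
  also have "\<dots> \<le> (\<integral>\<^sup>+(z::'a \<times> 'b). ennreal (weight (a - 2) (- b) z * (trial \<sigma> \<tau> n z)\<^sup>2) \<partial>lborel)"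
  proof (rule nn_integral_mono)
    fix z :: "'a \<times> 'b"
    show "?h (ln (norm z)) * (ennreal (weight (a - 2 + 2 * \<sigma>) (- b + 2 * \<tau>) z) * indicator S z)
        \<le> ennreal (weight (a - 2) (- b) z * (trial \<sigma> \<tau> n z)\<^sup>2)"
    proof (cases "fst z \<noteq> 0 \<and> z \<in> S \<and> ln (norm z) \<in> {- (n / 4)..n / 4}")
      case True
      then have z: "fst z \<noteq> 0" "z \<noteq> 0" and lz: "\<bar>ln (norm z)\<bar> \<le> n / 4" by auto
      have "norm (fst z) \<le> norm z" using norm_fst_le[of "fst z" "snd z"] by simp
      then have "ln (norm (fst z)) \<le> ln (norm z)" using z by simp
      moreover have "ln (exp (- 1) * norm z) \<le> ln (norm (fst z))"
        using True z by (subst ln_le_cancel_iff) (auto simp: S_def)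
      then have "ln (norm z) - 1 \<le> ln (norm (fst z))" using z by (simp add: ln_mult)
      ultimately have ly: "\<bar>ln (norm (fst z))\<bar> \<le> n / 2" using lz n by linarith
      have "exp (- 4) * exp (- 4) \<le> bump (ln (norm (fst z)) / n) * bump (ln (norm z) / n)"
        using ly lz n by (intro mult_mono bump_lower bump_bounds) (auto simp: abs_divide field_simps)
      then have "(exp (- 8))\<^sup>2 \<le> (bump (ln (norm (fst z)) / n) * bump (ln (norm z) / n))\<^sup>2"
        by (intro power_mono) (simp_all add: exp_add[symmetric])
      then have "exp (- 16) \<le> (bump (ln (norm (fst z)) / n) * bump (ln (norm z) / n))\<^sup>2"
        by (simp add: exp_double[symmetric])
      then have "exp (- 16) * weight (a - 2 + 2 * \<sigma>) (- b + 2 * \<tau>) z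
          \<le> (bump (ln (norm (fst z)) / n) * bump (ln (norm z) / n))\<^sup>2 * weight (a - 2 + 2 * \<sigma>) (- b + 2 * \<tau>) z"
        by (rule mult_right_mono) simp
      also have "\<dots> = weight (a - 2) (- b) z * (trial \<sigma> \<tau> n z)\<^sup>2"
        unfolding trial_eq[OF z(1)] power_mult_distrib[of "weight _ _ _"] weight_square
          weight_mult[of "a - 2" "- b" z, symmetric] by (simp only: mult_ac)
      finally show ?thesis
        using True by (simp add: ennreal_mult[symmetric] ennreal_leI)
    next
      case False
      then have "?h (ln (norm z)) * (ennreal (weight (a - 2 + 2 * \<sigma>) (- b + 2 * \<tau>) z) * indicator S z) = 0"
        by (auto simp: indicator_def)
      then show ?thesis by (simp only: zero_le)
    qed
  qed
  finally show ?thesis unfolding h .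
qed

text \<open>
  For these \<open>\<sigma>\<close> and \<open>\<tau>\<close> the weight \<open>|y|\<^sup>a\<^sup>-\<^sup>2 |z|\<^sup>-\<^sup>b |y|\<^sup>2\<^sup>\<sigma> |z|\<^sup>2\<^sup>\<tau>\<close> is homogeneous of degree \<open>-(k + m)\<close> with
  exponent \<open>2 s - k\<close> on \<open>|y|\<close>, hence integrable on the shell precisely when \<open>s > 0\<close>. The remainder is then
  \<open>O(1/n)\<close> and the mass at least a multiple of \<open>n\<close>.
\<close>

lemma near_extremals:
  fixes a b s \<delta> :: real
  defines "k \<equiv> real DIM('a::euclidean_space)" and "m \<equiv> real DIM('b::euclidean_space)"
  defines "\<sigma> \<equiv> s - (k + a - 2) / 2"
  defines "\<tau> \<equiv> - ((k + m + a - 2 - b) / 2 + \<sigma>)"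
  assumes a: "k + a > 2" and b: "k + m + a - 2 - b > 0" and s: "s > 0" and \<delta>: "\<delta> > 0"
  obtains u :: "'a::euclidean_space \<times> 'b::euclidean_space \<Rightarrow> real" where "u \<in> Cc_infinity"
    "0 < (\<integral>z. weight (a - 2) (- b) z * (u z)\<^sup>2 \<partial>lborel)"
    "(\<integral>z. weight a (- b) z * (norm (grad u z - u z *\<^sub>R hardy_field \<sigma> \<tau> z))\<^sup>2 \<partial>lborel)
      \<le> \<delta> * (\<integral>z. weight (a - 2) (- b) z * (u z)\<^sup>2 \<partial>lborel)"
proof -
  define p where "p = a - 2 + 2 * \<sigma>"
  define q where "q = - b + 2 * \<tau>"
  have hom: "a - 2 + 2 * \<sigma> - b + 2 * \<tau> = - k - m"
    by (simp add: \<sigma>_def \<tau>_def field_simps)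
  have p: "k + p > 0" using s by (simp add: p_def \<sigma>_def field_simps)
  define S where "S = {z :: 'a \<times> 'b. exp (- 1) * norm z \<le> norm (fst z)}"
  define A where "A = (\<integral>\<^sup>+(z::'a \<times> 'b). ennreal (weight p q z) * indicator {0..<1} (ln (norm z)) \<partial>lborel)"
  define A' where "A' = (\<integral>\<^sup>+z. ennreal (weight p q z) * indicator S z * indicator {0..<1} (ln (norm z)) \<partial>lborel)"
  have A: "A < \<infinity>"
    unfolding A_def by (rule weight_shell_finite) (use p in \<open>simp add: k_def\<close>)
  have "A' \<le> A" unfolding A_def A'_def by (intro nn_integral_mono) (auto simp: indicator_def)
  then have A'2: "A' < \<infinity>" using A by (rule le_less_trans)
  have A'1: "0 < A'" unfolding A'_def S_def by (rule cone_shell_pos)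
  define \<alpha> where "\<alpha> = enn2real A"
  define \<alpha>' where "\<alpha>' = enn2real A'"
  have \<alpha>: "A = ennreal \<alpha>" "0 \<le> \<alpha>" "A' = ennreal \<alpha>'" "0 < \<alpha>'"
    using A A'1 A'2 by (auto simp: \<alpha>_def \<alpha>'_def ennreal_enn2real enn2real_positive_iff)
  obtain K where K: "1 \<le> K" "\<And>t. \<bar>deriv bump t\<bar> \<le> K" using deriv_bump_bound by blast
  \<comment> \<open>Makes \<open>8 K\<^sup>2 \<alpha> / n \<le> 8 K\<^sup>2 \<alpha> \<le> \<delta> \<cdot> e\<^sup>-\<^sup>1\<^sup>6 n \<alpha>' / 2\<close>; one of the two factors \<open>n\<close> suffices.\<close>
  define n where "n = max 4 (16 * K\<^sup>2 * \<alpha> / (\<delta> * exp (- 16) * \<alpha>'))"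
  have n: "n \<ge> 4" "n > 0" "n \<ge> 16 * K\<^sup>2 * \<alpha> / (\<delta> * exp (- 16) * \<alpha>')" by (auto simp: n_def)
  define u :: "'a \<times> 'b \<Rightarrow> real" where "u = trial \<sigma> \<tau> n"
  have u: "u \<in> Cc_infinity" unfolding u_def by (rule trial_Cc_infinity[OF n(2)])
  define M where "M = (\<integral>z. weight (a - 2) (- b) z * (u z)\<^sup>2 \<partial>lborel)"
  define R where "R = (\<integral>z. weight a (- b) z * (norm (grad u z - u z *\<^sub>R hardy_field \<sigma> \<tau> z))\<^sup>2 \<partial>lborel)"
  note ints = hardy_identity(1,3)[OF u a[unfolded k_def] b[unfolded k_def m_def]]
  have R0: "0 \<le> R" and M0: "0 \<le> M" unfolding R_def M_def by (intro integral_nonneg_AE; simp)+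
  have "ennreal R = (\<integral>\<^sup>+z. ennreal (weight a (- b) z * (norm (grad u z - u z *\<^sub>R hardy_field \<sigma> \<tau> z))\<^sup>2) \<partial>lborel)"
    unfolding R_def by (rule nn_integral_eq_integral[symmetric, OF ints(2)]) simp
  also have "\<dots> \<le> ennreal (8 * K\<^sup>2 / n) * A"
    unfolding u_def A_def p_def q_def
    by (rule trial_remainder_upper[OF n(2) K hom[unfolded k_def m_def]])
  also have "\<dots> = ennreal (8 * K\<^sup>2 / n * \<alpha>)"
    unfolding \<alpha>(1) using \<alpha> n by (intro ennreal_mult[symmetric]) auto
  finally have "ennreal R \<le> ennreal (8 * K\<^sup>2 / n * \<alpha>)" .
  then have R: "R \<le> 8 * K\<^sup>2 / n * \<alpha>"
    using \<alpha> n by (subst (asm) ennreal_le_iff) auto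
  have "ennreal (exp (- 16) * n / 2 * \<alpha>') = ennreal (exp (- 16) * n / 2) * A'"
    unfolding \<alpha>(3) using \<alpha> n by (intro ennreal_mult) auto
  also have "\<dots>
      \<le> (\<integral>\<^sup>+z. ennreal (weight (a - 2) (- b) z * (u z)\<^sup>2) \<partial>lborel)"
    unfolding u_def A'_def p_def q_def S_def
    by (rule trial_mass_lower[OF n(1) hom[unfolded k_def m_def]])
  also have "\<dots> = ennreal M"
    unfolding M_def by (rule nn_integral_eq_integral[OF ints(1)]) simp
  finally have "ennreal (exp (- 16) * n / 2 * \<alpha>') \<le> ennreal M" .
  then have M: "exp (- 16) * n / 2 * \<alpha>' \<le> M"
    using M0 by (subst (asm) ennreal_le_iff) auto
  have "8 * K\<^sup>2 / n * \<alpha> \<le> 8 * K\<^sup>2 * \<alpha>"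
    using n(1) \<alpha>(2) divide_left_mono[of 1 n "8 * K\<^sup>2 * \<alpha>"] by simp
  also have "\<dots> \<le> \<delta> * (exp (- 16) * n / 2 * \<alpha>')"
    using n(3) \<delta> \<alpha> by (simp add: field_simps)
  also have "\<dots> \<le> \<delta> * M" using M \<delta> by (intro mult_left_mono) auto
  finally have "R \<le> \<delta> * M" using R by linarith
  moreover have "0 < exp (- 16) * n / 2 * \<alpha>'" using n \<alpha> by simp
  then have "0 < M" using M by linarith
  ultimately show thesis using that[OF u] unfolding M_def R_def by blast
qed

section \<open>Bounds for the best constant\<close>

lemma H_eq: "H d a b = H d a 0 - b / 2"
  by (simp add: H_def field_simps)

lemma energy_weight: "energy a b u = (\<integral>z. weight a (- b) z * (norm (grad u z))\<^sup>2 \<partial>lborel)"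
  and mass_weight: "mass a b u = (\<integral>z. weight (a - 2) (- b) z * (u z)\<^sup>2 \<partial>lborel)"
  by (simp_all add: energy_def mass_def weight_def)

text \<open>
  The coefficient \<open>C(s)\<close> of \<open>\<integral> |y|\<^sup>a |z|\<^sup>-\<^sup>b\<^sup>-\<^sup>2 u\<^sup>2\<close> in the energy identity; \<open>m / 2\<close> is \<open>H\<^sub>0 - \<Lambda>\<^sub>0\<close>.
\<close>

definition origin_coeff :: "nat \<Rightarrow> nat \<Rightarrow> real \<Rightarrow> real \<Rightarrow> real \<Rightarrow> real" where
  "origin_coeff k m a b s = (s + real m / 2)\<^sup>2 - ((H (k + m) a 0)\<^sup>2 - (H (k + m) a b)\<^sup>2)"

text \<open>
  With \<open>\<sigma> = s - \<Lambda>\<^sub>0\<close> the coefficient of the mass becomes \<open>- \<sigma> (\<sigma> + 2 \<Lambda>\<^sub>0) = \<Lambda>\<^sub>0\<^sup>2 - s\<^sup>2\<close>. The coefficient of the other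
  term, \<open>\<sigma> b - \<tau> (\<tau> + 2 \<sigma> + 2 H\<^sub>b)\<close>, is maximal for \<open>\<tau> = - (H\<^sub>b + \<sigma>)\<close>, with maximum \<open>\<sigma> b + (H\<^sub>b + \<sigma>)\<^sup>2 = C(s)\<close>.
\<close>

lemma energy_identity:
  fixes u :: "(real^'k::finite) \<times> (real^'m::finite) \<Rightarrow> real"
  defines "k \<equiv> CARD('k)" and "m \<equiv> CARD('m)"
  assumes u: "u \<in> Cc_infinity" and a: "real k + a > 2" and b: "b < 2 * H (k + m) a 0"
  shows "energy a b u = ((Lambda0 k a)\<^sup>2 - s\<^sup>2) * mass a b u
    + origin_coeff k m a b s * (\<integral>z. weight a (- b - 2) z * (u z)\<^sup>2 \<partial>lborel)
    + (\<integral>z. weight a (- b) z * (norm (grad u z - u z *\<^sub>R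
        hardy_field (s - Lambda0 k a) (- (H (k + m) a b + (s - Lambda0 k a))) z))\<^sup>2 \<partial>lborel)"
proof -
  define L where "L = Lambda0 k a"
  define h where "h = H (k + m) a b"
  have L: "real k + a - 2 = 2 * L" by (simp add: L_def Lambda0_def)
  have h: "real k + real m + a - 2 - b = 2 * h" by (simp add: h_def H_def)
  have H0: "H (k + m) a 0 = L + real m / 2" by (simp add: L_def Lambda0_def H_def field_simps)
  have bh: "b = 2 * (L + real m / 2 - h)" using L h by (simp add: field_simps)
  have "energy a b u
      = - (s - L) * ((s - L) + real k + a - 2) * mass a b u
        + ((s - L) * b - (- (h + (s - L))) * (- (h + (s - L)) + 2 * (s - L) + real k + real m + a - 2 - b))
            * (\<integral>z. weight a (- b - 2) z * (u z)\<^sup>2 \<partial>lborel)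
        + (\<integral>z. weight a (- b) z * (norm (grad u z - u z *\<^sub>R hardy_field (s - L) (- (h + (s - L))) z))\<^sup>2 \<partial>lborel)"
    unfolding energy_weight mass_weight k_def m_def
    by (rule hardy_identity(4)[OF u, unfolded DIM_cart DIM_real mult_1_right])
       (use a b in \<open>simp_all add: k_def m_def H_def\<close>)
  moreover have "- (s - L) * ((s - L) + real k + a - 2) = L\<^sup>2 - s\<^sup>2"
  proof -
    have "(s - L) + real k + a - 2 = s + L" using L by simp
    then show ?thesis by (simp only:) (simp add: power2_eq_square algebra_simps)
  qed
  moreover have "(s - L) * b - (- (h + (s - L))) *
      (- (h + (s - L)) + 2 * (s - L) + real k + real m + a - 2 - b) = origin_coeff k m a b s"
  proof -
    have "- (h + (s - L)) + 2 * (s - L) + real k + real m + a - 2 - b = h + (s - L)"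
      using h by simp
    then show ?thesis
      unfolding origin_coeff_def H0 h_def[symmetric]
      by (simp only:, subst bh) (simp add: power2_eq_square algebra_simps)
  qed
  ultimately show ?thesis unfolding L_def h_def by simp
qed

lemma mass_pos:
  fixes u :: "(real^'k::finite) \<times> (real^'m::finite) \<Rightarrow> real"
  assumes u: "u \<in> Cc_infinity" "u \<noteq> (\<lambda>_. 0)"
    and a: "real CARD('k) + a > 2" and b: "b < 2 * H (CARD('k) + CARD('m)) a 0"
  shows "0 < mass a b u"
  unfolding mass_weight
  by (rule weighted_square_integral_pos[OF Cc_infinityD(2)[OF u(1)] u(2) hardy_identity(1)[OF u(1)]])
     (use a b in \<open>simp_all add: H_def\<close>)

lemma weight_integral_nonneg: "0 \<le> (\<integral>z. weight p q z * (f z)\<^sup>2 \<partial>lborel)"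
  by (intro integral_nonneg_AE) simp

lemma near_extremal_test_function:
  defines "k \<equiv> CARD('k::finite)" and "m \<equiv> CARD('m::finite)"
  assumes a: "real k + a > 2" and b: "b < 2 * H (k + m) a 0" and s: "s > 0" and \<delta>: "\<delta> > 0"
  obtains u :: "(real^'k::finite) \<times> (real^'m::finite) \<Rightarrow> real" where "u \<in> Cc_infinity" "0 < mass a b u"
    "(\<integral>z. weight a (- b) z * (norm (grad u z - u z *\<^sub>R
        hardy_field (s - Lambda0 k a) (- (H (k + m) a b + (s - Lambda0 k a))) z))\<^sup>2 \<partial>lborel)
      \<le> \<delta> * mass a b u"
proof -
  have L: "Lambda0 k a = (real DIM(real^'k) + a - 2) / 2"
    by (simp add: Lambda0_def k_def)
  have h: "H (k + m) a b = (real DIM(real^'k) + real DIM(real^'m) + a - 2 - b) / 2"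
    by (simp add: H_def k_def m_def)
  show thesis
    by (rule near_extremals[where 'a = "real^'k" and 'b = "real^'m", of a b s \<delta>, folded mass_weight L h])
       (use that a b s \<delta> in \<open>simp_all add: k_def m_def H_def\<close>)
qed

lemma best_const_lower:
  assumes a: "real CARD('k::finite) + a > 2" and b: "b < 2 * H (CARD('k) + CARD('m::finite)) a 0"
    and s: "0 \<le> origin_coeff CARD('k) CARD('m) a b s"
  shows "(Lambda0 CARD('k) a)\<^sup>2 - s\<^sup>2 \<le> best_const TYPE('k) TYPE('m) a b"
  unfolding best_const_def
proof (rule cInf_greatest)
  obtain u :: "(real^'k) \<times> (real^'m) \<Rightarrow> real" where "u \<in> Cc_infinity" "0 < mass a b u"
    using near_extremal_test_function[OF a b zero_less_one zero_less_one] by blast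
  moreover from this have "u \<noteq> (\<lambda>_. 0)" by (auto simp: mass_def)
  ultimately show "{energy a b u / mass a b u | u :: (real^'k) \<times> (real^'m) \<Rightarrow> real.
      u \<in> Cc_infinity \<and> u \<noteq> (\<lambda>_. 0)} \<noteq> {}" by blast
next
  fix x assume "x \<in> {energy a b u / mass a b u | u :: (real^'k) \<times> (real^'m) \<Rightarrow> real.
      u \<in> Cc_infinity \<and> u \<noteq> (\<lambda>_. 0)}"
  then obtain u :: "(real^'k) \<times> (real^'m) \<Rightarrow> real" where u: "u \<in> Cc_infinity" "u \<noteq> (\<lambda>_. 0)"
    and x: "x = energy a b u / mass a b u" by blast
  have M: "0 < mass a b u" by (rule mass_pos[OF u a b])
  have "((Lambda0 CARD('k) a)\<^sup>2 - s\<^sup>2) * mass a b u \<le> energy a b u"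
    unfolding energy_identity[OF u(1) a b, of s]
    by (intro add_increasing2 order_refl mult_nonneg_nonneg s weight_integral_nonneg add_nonneg_nonneg)
  then show "(Lambda0 CARD('k) a)\<^sup>2 - s\<^sup>2 \<le> x"
    unfolding x using M by (simp add: le_divide_eq)
qed

lemma best_const_le_quotient:
  fixes u :: "(real^'k::finite) \<times> (real^'m::finite) \<Rightarrow> real"
  assumes "u \<in> Cc_infinity" "0 < mass a b u"
  shows "best_const TYPE('k) TYPE('m) a b \<le> energy a b u / mass a b u"
  unfolding best_const_def
proof (rule cInf_lower)
  have "u \<noteq> (\<lambda>_. 0)" using assms(2) by (auto simp: mass_def)
  then show "energy a b u / mass a b u \<in> {energy a b u / mass a b u | u :: (real^'k) \<times> (real^'m) \<Rightarrow> real.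
      u \<in> Cc_infinity \<and> u \<noteq> (\<lambda>_. 0)}" using assms(1) by blast
  show "bdd_below {energy a b u / mass a b u | u :: (real^'k) \<times> (real^'m) \<Rightarrow> real.
      u \<in> Cc_infinity \<and> u \<noteq> (\<lambda>_. 0)}"
    by (rule bdd_belowI[of _ 0]) (auto simp: energy_weight mass_weight intro!: divide_nonneg_nonneg weight_integral_nonneg)
qed

text \<open>
  Let \<open>M\<close> be the mass, \<open>N = \<integral> |y|\<^sup>a |z|\<^sup>-\<^sup>b\<^sup>-\<^sup>2 u\<^sup>2\<close>, and \<open>R\<^sub>s\<close> the remainder. Subtracting the energy identities for \<open>s\<close>
  and \<open>2 s\<close> gives \<open>s (3 s + m) N = 3 s\<^sup>2 M + R\<^sub>s - R\<^sub>2\<^sub>s\<close>. Since \<open>R\<^sub>2\<^sub>s \<ge> 0\<close>, a test function with \<open>R\<^sub>s \<le> \<delta> M\<close> satisfies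
  \<open>N \<le> (3 s\<^sup>2 + \<delta>) / (s m) M\<close>; then let \<open>\<delta> \<rightarrow> 0\<close>.
\<close>

lemma best_const_upper:
  defines "k \<equiv> CARD('k::finite)" and "m \<equiv> CARD('m::finite)"
  assumes a: "real k + a > 2" and b: "b < 2 * H (k + m) a 0" and s: "s > 0"
  shows "best_const TYPE('k) TYPE('m) a b
    \<le> (Lambda0 k a)\<^sup>2 - s\<^sup>2 + \<bar>origin_coeff k m a b s\<bar> * (3 * s / real m)"
proof -
  define c where "c = origin_coeff k m a b s"
  have m: "real m > 0" by (simp add: m_def)
  have bound: "best_const TYPE('k) TYPE('m) a b
      \<le> (Lambda0 k a)\<^sup>2 - s\<^sup>2 + \<bar>c\<bar> * ((3 * s\<^sup>2 + \<delta>) / (s * real m)) + \<delta>" if \<delta>: "\<delta> > 0" for \<delta>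
  proof -
    define R where "R r u = (\<integral>z. weight a (- b) z * (norm (grad u z - u z *\<^sub>R
        hardy_field (r - Lambda0 k a) (- (H (k + m) a b + (r - Lambda0 k a))) z))\<^sup>2 \<partial>lborel)"
      for r and u :: "(real^'k) \<times> (real^'m) \<Rightarrow> real"
    obtain u :: "(real^'k) \<times> (real^'m) \<Rightarrow> real" where u: "u \<in> Cc_infinity" and M: "0 < mass a b u"
      and R: "R s u \<le> \<delta> * mass a b u"
      using near_extremal_test_function[where 'k = 'k and 'm = 'm, folded k_def m_def, OF a b s \<delta>]
      unfolding R_def by blast
    define N where "N = (\<integral>z. weight a (- b - 2) z * (u z)\<^sup>2 \<partial>lborel)"
    define M where "M = mass a b u"
    note id = energy_identity[OF u a[unfolded k_def] b[unfolded k_def m_def], folded k_def m_def, folded R_def N_def M_def]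
    have N: "0 \<le> N" unfolding N_def by (rule weight_integral_nonneg)
    have R2: "0 \<le> R (2 * s) u" unfolding R_def by (rule weight_integral_nonneg)
    have diff: "origin_coeff k m a b (2 * s) - c = s * (3 * s + real m)"
      by (simp add: c_def origin_coeff_def power2_eq_square algebra_simps)
    have "s * real m * N \<le> s * (3 * s + real m) * N"
      using N s by (intro mult_right_mono mult_left_mono) auto
    also have "\<dots> = (origin_coeff k m a b (2 * s) - c) * N" by (simp only: diff)
    also have "\<dots> = 3 * s\<^sup>2 * M + R s u - R (2 * s) u"
      using id[of s] id[of "2 * s"] by (simp add: c_def algebra_simps power2_eq_square)
    also have "\<dots> \<le> (3 * s\<^sup>2 + \<delta>) * M"
      using R R2 by (simp add: M_def algebra_simps)
    finally have "N \<le> (3 * s\<^sup>2 + \<delta>) / (s * real m) * M"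
      using s m by (simp add: field_simps)
    then have "\<bar>c\<bar> * N \<le> \<bar>c\<bar> * ((3 * s\<^sup>2 + \<delta>) / (s * real m) * M)"
      by (rule mult_left_mono) simp
    moreover have "c * N \<le> \<bar>c\<bar> * N" using N by (intro mult_right_mono) auto
    ultimately have "energy a b u \<le> ((Lambda0 k a)\<^sup>2 - s\<^sup>2) * M
        + \<bar>c\<bar> * ((3 * s\<^sup>2 + \<delta>) / (s * real m) * M) + \<delta> * M"
      using id[of s] R by (simp add: c_def M_def)
    also have "\<dots> = ((Lambda0 k a)\<^sup>2 - s\<^sup>2 + \<bar>c\<bar> * ((3 * s\<^sup>2 + \<delta>) / (s * real m)) + \<delta>) * M"
      by (simp add: algebra_simps)
    finally have "energy a b u / mass a b u
        \<le> (Lambda0 k a)\<^sup>2 - s\<^sup>2 + \<bar>c\<bar> * ((3 * s\<^sup>2 + \<delta>) / (s * real m)) + \<delta>"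
      using M by (simp add: divide_le_eq M_def)
    then show ?thesis using best_const_le_quotient[OF u M] by linarith
  qed
  have "((\<lambda>\<delta>. (Lambda0 k a)\<^sup>2 - s\<^sup>2 + \<bar>c\<bar> * ((3 * s\<^sup>2 + \<delta>) / (s * real m)) + \<delta>)
      \<longlongrightarrow> (Lambda0 k a)\<^sup>2 - s\<^sup>2 + \<bar>c\<bar> * ((3 * s\<^sup>2 + 0) / (s * real m)) + 0) (at_right 0)"
    using s m by (intro tendsto_intros) auto
  then have "best_const TYPE('k) TYPE('m) a b
      \<le> (Lambda0 k a)\<^sup>2 - s\<^sup>2 + \<bar>c\<bar> * ((3 * s\<^sup>2 + 0) / (s * real m)) + 0"
  proof (rule tendsto_lowerbound)
    show "\<forall>\<^sub>F \<delta> in at_right 0. best_const TYPE('k) TYPE('m) a b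
        \<le> (Lambda0 k a)\<^sup>2 - s\<^sup>2 + \<bar>c\<bar> * ((3 * s\<^sup>2 + \<delta>) / (s * real m)) + \<delta>"
      using eventually_at_right_less by eventually_elim (rule bound)
  qed simp
  then show ?thesis using s by (simp add: c_def power2_eq_square)
qed

text \<open>
  This is the limit \<open>s \<rightarrow> 0\<close>. The value \<open>s = 0\<close> itself cannot be used: there the shell integral of the trial
  weight diverges.
\<close>

lemma best_const_upper_Lambda0:
  assumes a: "real CARD('k::finite) + a > 2" and b: "b < 2 * H (CARD('k) + CARD('m::finite)) a 0"
  shows "best_const TYPE('k) TYPE('m) a b \<le> (Lambda0 CARD('k) a)\<^sup>2"
proof -
  have "((\<lambda>s. (Lambda0 CARD('k) a)\<^sup>2 - s\<^sup>2
        + \<bar>origin_coeff CARD('k) CARD('m) a b s\<bar> * (3 * s / real CARD('m)))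
      \<longlongrightarrow> (Lambda0 CARD('k) a)\<^sup>2 - 0\<^sup>2
        + \<bar>origin_coeff CARD('k) CARD('m) a b 0\<bar> * (3 * 0 / real CARD('m))) (at_right 0)"
    unfolding origin_coeff_def by (intro tendsto_intros) auto
  then have "best_const TYPE('k) TYPE('m) a b \<le> (Lambda0 CARD('k) a)\<^sup>2 - 0\<^sup>2
        + \<bar>origin_coeff CARD('k) CARD('m) a b 0\<bar> * (3 * 0 / real CARD('m))"
  proof (rule tendsto_lowerbound)
    show "\<forall>\<^sub>F s in at_right 0. best_const TYPE('k) TYPE('m) a b \<le> (Lambda0 CARD('k) a)\<^sup>2 - s\<^sup>2
        + \<bar>origin_coeff CARD('k) CARD('m) a b s\<bar> * (3 * s / real CARD('m))"
      using eventually_at_right_less by eventually_elim (rule best_const_upper[OF a b])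
  qed simp
  then show ?thesis by simp
qed

lemma best_const_eq_Lambda0_sq:
  assumes a: "real CARD('k::finite) + a > 2" and b: "b < 2 * H (CARD('k) + CARD('m::finite)) a 0"
    and c: "0 \<le> origin_coeff CARD('k) CARD('m) a b 0"
  shows "best_const TYPE('k) TYPE('m) a b = (Lambda0 CARD('k) a)\<^sup>2"
  using best_const_upper_Lambda0[OF a b] best_const_lower[OF a b c] by simp

lemma best_const_less_Lambda0_sq:
  assumes a: "real CARD('k::finite) + a > 2" and b: "b < 2 * H (CARD('k) + CARD('m::finite)) a 0"
    and s: "s > 0" and c: "origin_coeff CARD('k) CARD('m) a b s = 0"
  shows "best_const TYPE('k) TYPE('m) a b = (Lambda0 CARD('k) a)\<^sup>2 - s\<^sup>2"
  using best_const_upper[OF a b s] best_const_lower[OF a b, of s] c by simp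

text \<open>
  For \<open>\<beta> < \<beta>'\<close> the two characterizations contradict each other at \<open>b = \<beta>'\<close>.
\<close>

lemma is_b_star_unique:
  assumes "is_b_star K M a \<beta>" "is_b_star K M a \<beta>'"
  shows "\<beta> = \<beta>'"
proof -
  have "\<not> \<beta> < \<beta>'" if "is_b_star K M a \<beta>" "is_b_star K M a \<beta>'"
    for \<beta> \<beta>' and K :: "'k::finite itself" and M :: "'m::finite itself"
  proof
    assume less: "\<beta> < \<beta>'"
    then have "best_const K M a \<beta>' < (Lambda0 CARD('k) a)\<^sup>2"
      using that unfolding is_b_star_def Let_def by blast
    moreover have "best_const K M a \<beta>' = (Lambda0 CARD('k) a)\<^sup>2"
      using that unfolding is_b_star_def Let_def by blast
    ultimately show False by simp
  qed
  from this[OF assms] this[OF assms(2,1)] show ?thesis by linarith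
qed

theorem theorem5p4:
  fixes a :: real and k d :: nat
  assumes "1 \<le> k" and "k < d"
    and "CARD('k::finite) = k" and "CARD('m::finite) = d - k"
    and "real k + a > 2"
  defines "bs \<equiv> b_star TYPE('k) TYPE('m) a"
  shows "is_b_star TYPE('k) TYPE('m) a bs
    \<and> bs\<^sup>2 - 4 * H d a 0 * bs + 4 * (H d a 0 - Lambda0 k a)\<^sup>2 = 0
    \<and> (\<forall>r. r\<^sup>2 - 4 * H d a 0 * r + 4 * (H d a 0 - Lambda0 k a)\<^sup>2 = 0 \<longrightarrow> bs \<le> r)
    \<and> bs = 2 * H d a 0 - 2 * sqrt ((H d a 0)\<^sup>2 - (H d a 0 - Lambda0 k a)\<^sup>2)
    \<and> 0 < bs \<and> bs < 2 * H d a 0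
    \<and> (\<forall>b. bs < b \<and> b < 2 * H d a 0 \<longrightarrow>
          best_const TYPE('k) TYPE('m) a b
            = (Lambda0 k a)\<^sup>2 - (sqrt ((H d a 0)\<^sup>2 - (H d a b)\<^sup>2) - (H d a 0 - Lambda0 k a))\<^sup>2)"
proof -
  define m where "m = d - k"
  define H0 where "H0 = H d a 0"
  define D where "D = real m / 2"
  define w where "w = sqrt (H0\<^sup>2 - D\<^sup>2)"
  define \<beta> where "\<beta> = 2 * H0 - 2 * w"
  have d: "d = CARD('k) + CARD('m)" and k: "k = CARD('k)" and m: "m = CARD('m)"
    using assms(1-4) by (auto simp: m_def)
  have D: "H0 - Lambda0 k a = D" and D0: "0 < D"
    using assms(2) by (auto simp: H0_def H_def Lambda0_def D_def m_def field_simps of_nat_diff)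
  have "0 < Lambda0 k a" using assms(5) by (simp add: Lambda0_def)
  then have H0D: "D < H0" using D by linarith
  have sq: "0 < H0\<^sup>2 - D\<^sup>2" using H0D D0 by (simp add: power_strict_mono)
  have w2: "w\<^sup>2 = H0\<^sup>2 - D\<^sup>2" and w0: "0 < w" using sq by (simp_all add: w_def)
  have "w\<^sup>2 < H0\<^sup>2" using w2 D0 by simp
  then have wH: "w < H0" by (rule power2_less_imp_less) (use H0D D0 in linarith)
  have \<beta>: "0 < \<beta>" "\<beta> < 2 * H0" using wH w0 by (auto simp: \<beta>_def)
  have a: "real CARD('k) + a > 2" using assms(5) by (simp add: k)
  have def: "origin_coeff CARD('k) CARD('m) a b s = (s + D)\<^sup>2 - (H0\<^sup>2 - (H d a b)\<^sup>2)" for b s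
    by (simp add: origin_coeff_def H0_def d D_def m)
  have low: "best_const TYPE('k) TYPE('m) a b = (Lambda0 k a)\<^sup>2" if "b \<le> \<beta>" for b
    unfolding k
  proof (rule best_const_eq_Lambda0_sq[OF a])
    show "b < 2 * H (CARD('k) + CARD('m)) a 0" using that \<beta> by (simp add: H0_def d)
    have "w \<le> H d a b" using that unfolding H_eq[of d a b] H0_def[symmetric] \<beta>_def by simp
    then have "w\<^sup>2 \<le> (H d a b)\<^sup>2" using w0 by (intro power_mono) auto
    then show "0 \<le> origin_coeff CARD('k) CARD('m) a b 0" unfolding def w2 by simp
  qed
  have high: "best_const TYPE('k) TYPE('m) a b = (Lambda0 k a)\<^sup>2 - (sqrt (H0\<^sup>2 - (H d a b)\<^sup>2) - D)\<^sup>2"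
    and high_pos: "0 < sqrt (H0\<^sup>2 - (H d a b)\<^sup>2) - D" if "\<beta> < b" "b < 2 * H0" for b
  proof -
    have h: "0 < H d a b" "H d a b < w"
      using that unfolding H_eq[of d a b] H0_def[symmetric] \<beta>_def by simp_all
    then have "(H d a b)\<^sup>2 < w\<^sup>2" by (intro power_strict_mono) auto
    then have "D\<^sup>2 < H0\<^sup>2 - (H d a b)\<^sup>2" unfolding w2 by simp
    then have r: "D < sqrt (H0\<^sup>2 - (H d a b)\<^sup>2)" and nn: "0 < H0\<^sup>2 - (H d a b)\<^sup>2"
      by (rule real_less_rsqrt, rule le_less_trans[OF zero_le_power2])
    then show s: "0 < sqrt (H0\<^sup>2 - (H d a b)\<^sup>2) - D" by simp
    show "best_const TYPE('k) TYPE('m) a b = (Lambda0 k a)\<^sup>2 - (sqrt (H0\<^sup>2 - (H d a b)\<^sup>2) - D)\<^sup>2"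
      unfolding k
    proof (rule best_const_less_Lambda0_sq[OF a _ s])
      show "b < 2 * H (CARD('k) + CARD('m)) a 0" using that by (simp add: H0_def d)
      show "origin_coeff CARD('k) CARD('m) a b (sqrt (H0\<^sup>2 - (H d a b)\<^sup>2) - D) = 0"
        unfolding def using nn by simp
    qed
  qed
  have star: "is_b_star TYPE('k) TYPE('m) a \<beta>"
    unfolding is_b_star_def Let_def
    unfolding d[symmetric] unfolding k[symmetric] H0_def[symmetric]
    using \<beta> low high high_pos by (auto simp: less_imp_neq)
  have bs: "bs = \<beta>"
    unfolding bs_def b_star_def
    by (rule the_equality, rule star, rule is_b_star_unique[OF _ star])
  \<comment> \<open>Completing the square: the roots are \<open>2 H0 - 2 w\<close> and \<open>2 H0 + 2 w\<close>.\<close>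
  have root: "r\<^sup>2 - 4 * H0 * r + 4 * D\<^sup>2 = (r - 2 * H0)\<^sup>2 - (2 * w)\<^sup>2" for r
    unfolding power_mult_distrib[of 2 w] w2 by (simp add: power2_eq_square algebra_simps)
  have "\<beta> \<le> r" if "r\<^sup>2 - 4 * H0 * r + 4 * D\<^sup>2 = 0" for r
  proof -
    have "(r - 2 * H0)\<^sup>2 = (2 * w)\<^sup>2" using that unfolding root by linarith
    then have "r - 2 * H0 = 2 * w \<or> r - 2 * H0 = - (2 * w)" by (simp only: power2_eq_iff)
    then show ?thesis using w0 unfolding \<beta>_def by linarith
  qed
  moreover have "\<beta>\<^sup>2 - 4 * H0 * \<beta> + 4 * D\<^sup>2 = 0" unfolding root by (simp add: \<beta>_def)
  ultimately show ?thesis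
    unfolding bs H0_def[symmetric] D w_def[symmetric]
    using star \<beta> high by (auto simp: \<beta>_def[symmetric])
qed

end
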